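(* For a field $\mathbb{F}$ with $\mathrm{char}(\mathbb{F})\neq 3$, there is an isomorphism of group schemes (i.e. of group functors on commutative associative unital $\mathbb{F}$-algebras) $\mathbf{aut}(W_2)\cong\mathbf{Aff}_2$.
   Context: $W_2$ is the (non-associative, non-unital) 6-dimensional $\mathbb{F}$-algebra with basis $e_1,\dots,e_6$ and products (zero products omitted): $e_1e_1=-e_1$, $e_1e_2=-3e_2$, $e_1e_3=e_3$, $e_1e_4=3e_4$, $e_1e_5=-e_5$, $e_1e_6=e_6$; $e_2e_1=3e_2$, $e_2e_3=2e_1$, $e_2e_4=e_3$, $e_2e_6=-e_5$; $e_3e_1=-2e_3$, $e_3e_2=-e_1$, $e_3e_3=-3e_4$, $e_3e_5=e_6$; $e_5e_1=-2e_1$, $e_5e_2=-3e_2$, $e_5e_3=-e_3$, $e_5e_5=-2e_5$, $e_5e_6=-e_6$; $e_6e_1=2e_3$, $e_6e_2=e_1$, $e_6e_3=3e_4$, $e_6e_5=-e_6$. Let $\mathrm{Alg}_{\mathbb{F}}$ be the category of associative, commutative, unital $\mathbb{F}$-algebras and $\mathrm{Grp}$ the category of groups. $\mathbf{aut}(W_2)\colon \mathrm{Alg}_{\mathbb{F}}\to\mathrm{Grp}$ is the functor $R\mapsto \mathrm{Aut}_R(W_2\otimes_{\mathbb{F}}R)$ (group of $R$-algebra automorphisms). $\mathbf{Aff}_2\colon\mathrm{Alg}_{\mathbb{F}}\to\mathrm{Grp}$ is the functor $R\mapsto \mathrm{Aff}_2(R)=\left\{\begin{pmatrix}1&x\\0&t\end{pmatrix}: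 x\in R,\ t\in R^\times\right\}$ (group under matrix multiplication), where $R^\times$ is the group of units of $R$. An isomorphism of group functors is a natural family of group isomorphisms. *)

theory Defs
  imports "HOL-Algebra.Free_Abelian_Groups" "HOL-Algebra.Module" "HOL-Algebra.Bij"
begin

definition characteristic :: "('f, 'm) ring_scheme \<Rightarrow> nat" where
  "characteristic F =
     (if \<exists>n::nat. 0 < n \<and> [n] \<cdot>\<^bsub>F\<^esub> \<one>\<^bsub>F\<^esub> = \<zero>\<^bsub>F\<^esub>
      then LEAST n::nat. 0 < n \<and> [n] \<cdot>\<^bsub>F\<^esub> \<one>\<^bsub>F\<^esub> = \<zero>\<^bsub>F\<^esub> else 0)"


section \<open>The algebra \<open>W\<^sub>2\<close>\<close>

text \<open>
  Non-associative, non-unital algebras are \<^typ>\<open>('a, 'b) module\<close> records whose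
  \<^const>\<open>mult\<close> field is the product; the \<^const>\<open>one\<close> field carries no meaning
  and is left undefined.
\<close>

text \<open>An entry \<open>((i, j), (c, k))\<close> means \<open>e\<^sub>i e\<^sub>j = c e\<^sub>k\<close>; absent products are zero.\<close>

definition W2_table :: "((nat \<times> nat) \<times> (int \<times> nat)) list" where
  "W2_table =
    [((1, 1), (-1, 1)), ((1, 2), (-3, 2)), ((1, 3), (1, 3)),
     ((1, 4), (3, 4)), ((1, 5), (-1, 5)), ((1, 6), (1, 6)),
     ((2, 1), (3, 2)), ((2, 3), (2, 1)), ((2, 4), (1, 3)), ((2, 6), (-1, 5)),
     ((3, 1), (-2, 3)), ((3, 2), (-1, 1)), ((3, 3), (-3, 4)), ((3, 5), (1, 6)),
     ((5, 1), (-2, 1)), ((5, 2), (-3, 2)), ((5, 3), (-1, 3)),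
     ((5, 5), (-2, 5)), ((5, 6), (-1, 6)),
     ((6, 1), (2, 3)), ((6, 2), (1, 1)), ((6, 3), (3, 4)), ((6, 5), (-1, 6))]"

definition W2_const :: "nat \<Rightarrow> nat \<Rightarrow> nat \<Rightarrow> int" where
  "W2_const i j k =
     (case map_of W2_table (i, j) of
        None \<Rightarrow> 0
      | Some (c, l) \<Rightarrow> if l = k then c else 0)"

definition W2 :: "('f, 'm) ring_scheme \<Rightarrow> ('f, nat \<Rightarrow> 'f) module" where
  "W2 F =
    \<lparr>carrier = {1..6} \<rightarrow>\<^sub>E carrier F,
     monoid.mult = (\<lambda>x y. \<lambda>k\<in>{1..6}. \<Oplus>\<^bsub>F\<^esub>i\<in>{1..6}. \<Oplus>\<^bsub>F\<^esub>j\<in>{1..6}.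
               add_pow F (W2_const i j k) (x i \<otimes>\<^bsub>F\<^esub> y j)),
     one = undefined,
     zero = (\<lambda>k\<in>{1..6}. \<zero>\<^bsub>F\<^esub>),
     add = (\<lambda>x y. \<lambda>k\<in>{1..6}. x k \<oplus>\<^bsub>F\<^esub> y k),
     smult = (\<lambda>a x. \<lambda>k\<in>{1..6}. a \<otimes>\<^bsub>F\<^esub> x k)\<rparr>"


section \<open>Extension of scalars\<close>

text \<open>
  The tensor product of an \<open>F\<close>-module \<open>M\<close> and an \<open>F\<close>-algebra \<open>R\<close> is the
  free abelian group on \<open>M \<times> R\<close> modulo the usual bilinearity relations. The
  generator \<open>frag_of (m, r)\<close> represents the pure tensor \<open>m \<otimes> r\<close>.
\<close>

type_synonym ('w, 'r) tensor_rep = "'w \<times> 'r \<Rightarrow>\<^sub>0 int"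

type_synonym ('w, 'r) tensor = "('w, 'r) tensor_rep set"

definition tensor_free ::
    "('f, 'w) module \<Rightarrow> ('f, 'r) module \<Rightarrow> ('w, 'r) tensor_rep monoid" where
  "tensor_free M R = free_Abelian_group (carrier M \<times> carrier R)"

definition tensor_relations ::
    "('f, 'm) ring_scheme \<Rightarrow> ('f, 'w) module \<Rightarrow> ('f, 'r) module \<Rightarrow> ('w, 'r) tensor_rep set" where
  "tensor_relations F M R =
     {frag_of (m \<oplus>\<^bsub>M\<^esub> m', r) - frag_of (m, r) - frag_of (m', r) | m m' r.
        m \<in> carrier M \<and> m' \<in> carrier M \<and> r \<in> carrier R} \<union>
     {frag_of (m, r \<oplus>\<^bsub>R\<^esub> r') - frag_of (m, r) - frag_of (m, r') | m r r'.
        m \<in> carrier M \<and> r \<in> carrier R \<and> r' \<in> carrier R} \<union>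
     {frag_of (a \<odot>\<^bsub>M\<^esub> m, r) - frag_of (m, a \<odot>\<^bsub>R\<^esub> r) | a m r.
        a \<in> carrier F \<and> m \<in> carrier M \<and> r \<in> carrier R}"

definition tensor_kernel ::
    "('f, 'm) ring_scheme \<Rightarrow> ('f, 'w) module \<Rightarrow> ('f, 'r) module \<Rightarrow> ('w, 'r) tensor_rep set" where
  "tensor_kernel F M R = generate (tensor_free M R) (tensor_relations F M R)"

definition tensor_class ::
    "('f, 'm) ring_scheme \<Rightarrow> ('f, 'w) module \<Rightarrow> ('f, 'r) module \<Rightarrow>
     ('w, 'r) tensor_rep \<Rightarrow> ('w, 'r) tensor" where
  "tensor_class F M R c = tensor_kernel F M R #>\<^bsub>tensor_free M R\<^esub> c"

text \<open>
  The \<open>R\<close>-algebra \<open>W \<otimes>\<^sub>F R\<close>, with \<open>(w \<otimes> r)(w' \<otimes> r') = ww' \<otimes> rr'\<close> and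
  \<open>s(w \<otimes> r) = w \<otimes> sr\<close>. As for the product of cosets in
  \<^const>\<open>FactGroup\<close>, operations on classes are unions over representatives,
  all of which contribute the same class.
\<close>

definition base_change ::
    "('f, 'm) ring_scheme \<Rightarrow> ('f, 'w) module \<Rightarrow> ('f, 'r) module \<Rightarrow>
     ('r, ('w, 'r) tensor) module" where
  "base_change F W R =
    \<lparr>carrier = carrier (tensor_free W R Mod tensor_kernel F W R),
     monoid.mult = (\<lambda>X Y. \<Union>c\<in>X. \<Union>d\<in>Y. tensor_class F W R
               (frag_extend (\<lambda>(w, r).
                  frag_extend (\<lambda>(w', r'). frag_of (w \<otimes>\<^bsub>W\<^esub> w', r \<otimes>\<^bsub>R\<^esub> r')) d) c)),
     one = undefined,
     zero = \<one>\<^bsub>tensor_free W R Mod tensor_kernel F W R\<^esub>,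
     add = (\<lambda>X Y. X \<otimes>\<^bsub>tensor_free W R Mod tensor_kernel F W R\<^esub> Y),
     smult = (\<lambda>s X. \<Union>c\<in>X. tensor_class F W R
                (frag_extend (\<lambda>(w, r). frag_of (w, s \<otimes>\<^bsub>R\<^esub> r)) c))\<rparr>"

text \<open>The map \<open>id \<otimes> f : W \<otimes>\<^sub>F R \<rightarrow> W \<otimes>\<^sub>F S\<close>.\<close>

definition base_change_map ::
    "('f, 'm) ring_scheme \<Rightarrow> ('f, 'w) module \<Rightarrow> ('f, 'r) module \<Rightarrow> ('r \<Rightarrow> 'r) \<Rightarrow>
     ('w, 'r) tensor \<Rightarrow> ('w, 'r) tensor" where
  "base_change_map F W S f X =
     (\<Union>c\<in>X. tensor_class F W S (frag_extend (\<lambda>(w, r). frag_of (w, f r)) c))"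


section \<open>Group functors on commutative algebras\<close>

text \<open>
  The objects are the \<open>R\<close> with \<^term>\<open>algebra F R\<close>, which makes \<open>R\<close> an associative,
  commutative, unital \<open>F\<close>-algebra. Homomorphisms are taken extensional, so that they are
  determined by their values on the carrier.
\<close>

definition alg_hom ::
    "('f, 'm) ring_scheme \<Rightarrow> ('f, 'r) module \<Rightarrow> ('f, 'r) module \<Rightarrow> ('r \<Rightarrow> 'r) set" where
  "alg_hom F R S =
     {f \<in> ring_hom R S \<inter> extensional (carrier R).
        \<forall>a\<in>carrier F. \<forall>x\<in>carrier R. f (a \<odot>\<^bsub>R\<^esub> x) = a \<odot>\<^bsub>S\<^esub> f x}"

record ('f, 'r, 'g) gfunctor =
  gobj :: "('f, 'r) module \<Rightarrow> 'g monoid"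
  gmap :: "('f, 'r) module \<Rightarrow> ('f, 'r) module \<Rightarrow> ('r \<Rightarrow> 'r) \<Rightarrow> 'g \<Rightarrow> 'g"

definition group_functor ::
    "('f, 'm) ring_scheme \<Rightarrow> ('f, 'r, 'g) gfunctor \<Rightarrow> bool" where
  "group_functor F G \<longleftrightarrow>
     (\<forall>R. algebra F R \<longrightarrow> group (gobj G R)) \<and>
     (\<forall>R S f. algebra F R \<longrightarrow> algebra F S \<longrightarrow> f \<in> alg_hom F R S \<longrightarrow>
        gmap G R S f \<in> hom (gobj G R) (gobj G S)) \<and>
     (\<forall>R. algebra F R \<longrightarrow>
        (\<forall>g\<in>carrier (gobj G R). gmap G R R (\<lambda>x\<in>carrier R. x) g = g)) \<and>
     (\<forall>R S T f h. algebra F R \<longrightarrow> algebra F S \<longrightarrow> algebra F T \<longrightarrow>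
        f \<in> alg_hom F R S \<longrightarrow> h \<in> alg_hom F S T \<longrightarrow>
        (\<forall>g\<in>carrier (gobj G R).
           gmap G R T (compose (carrier R) h f) g = gmap G S T h (gmap G R S f g)))"

definition group_functor_isomorphic ::
    "('f, 'm) ring_scheme \<Rightarrow> ('f, 'r, 'g) gfunctor \<Rightarrow> ('f, 'r, 'h) gfunctor \<Rightarrow> bool" where
  "group_functor_isomorphic F G H \<longleftrightarrow>
     group_functor F G \<and> group_functor F H \<and>
     (\<exists>\<theta>. (\<forall>R. algebra F R \<longrightarrow> \<theta> R \<in> iso (gobj G R) (gobj H R)) \<and>
          (\<forall>R S f. algebra F R \<longrightarrow> algebra F S \<longrightarrow> f \<in> alg_hom F R S \<longrightarrow>
             (\<forall>g\<in>carrier (gobj G R). \<theta> S (gmap G R S f g) = gmap H R S f (\<theta> R g))))"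


section \<open>The automorphism group functor\<close>

definition alg_auto :: "('r, 'n) ring_scheme \<Rightarrow> ('r, 'a) module \<Rightarrow> ('a \<Rightarrow> 'a) set" where
  "alg_auto R A =
     {\<phi> \<in> Bij (carrier A).
        (\<forall>x\<in>carrier A. \<forall>y\<in>carrier A. \<phi> (x \<oplus>\<^bsub>A\<^esub> y) = \<phi> x \<oplus>\<^bsub>A\<^esub> \<phi> y) \<and>
        (\<forall>x\<in>carrier A. \<forall>y\<in>carrier A. \<phi> (x \<otimes>\<^bsub>A\<^esub> y) = \<phi> x \<otimes>\<^bsub>A\<^esub> \<phi> y) \<and>
        (\<forall>s\<in>carrier R. \<forall>x\<in>carrier A. \<phi> (s \<odot>\<^bsub>A\<^esub> x) = s \<odot>\<^bsub>A\<^esub> \<phi> x)}"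

definition AlgAutoGroup :: "('r, 'n) ring_scheme \<Rightarrow> ('r, 'a) module \<Rightarrow> ('a \<Rightarrow> 'a) monoid" where
  "AlgAutoGroup R A = BijGroup (carrier A) \<lparr>carrier := alg_auto R A\<rparr>"

text \<open>
  Along \<open>f : R \<rightarrow> S\<close>, an automorphism \<open>\<phi>\<close> of \<open>W \<otimes>\<^sub>F R\<close> is sent to its base change
  \<open>\<phi> \<otimes>\<^sub>R S\<close> under the identification \<open>(W \<otimes>\<^sub>F R) \<otimes>\<^sub>R S = W \<otimes>\<^sub>F S\<close>. Since the image of
  \<open>id \<otimes> f\<close> generates \<open>W \<otimes>\<^sub>F S\<close> over \<open>S\<close>, this is the unique automorphism \<open>\<psi>\<close> with
  \<open>\<psi> \<circ> (id \<otimes> f) = (id \<otimes> f) \<circ> \<phi>\<close>.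
\<close>

definition aut_functor ::
    "('f, 'm) ring_scheme \<Rightarrow> ('f, 'w) module \<Rightarrow>
     ('f, 'r, ('w, 'r) tensor \<Rightarrow> ('w, 'r) tensor) gfunctor" where
  "aut_functor F W =
    \<lparr>gobj = (\<lambda>R. AlgAutoGroup R (base_change F W R)),
     gmap = (\<lambda>R S f \<phi>. THE \<psi>. \<psi> \<in> alg_auto S (base_change F W S) \<and>
               (\<forall>x\<in>carrier (base_change F W R).
                  \<psi> (base_change_map F W S f x) = base_change_map F W S f (\<phi> x)))\<rparr>"


section \<open>The affine group functor\<close>

text \<open>\<open>Mat2 a b c d\<close> is the matrix with rows \<open>(a, b)\<close> and \<open>(c, d)\<close>.\<close>

datatype 'r mat2 = Mat2 'r 'r 'r 'r

fun mat2_mult :: "('r, 'n) ring_scheme \<Rightarrow> 'r mat2 \<Rightarrow> 'r mat2 \<Rightarrow> 'r mat2" where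
  "mat2_mult R (Mat2 a b c d) (Mat2 a' b' c' d') =
     Mat2 (a \<otimes>\<^bsub>R\<^esub> a' \<oplus>\<^bsub>R\<^esub> b \<otimes>\<^bsub>R\<^esub> c') (a \<otimes>\<^bsub>R\<^esub> b' \<oplus>\<^bsub>R\<^esub> b \<otimes>\<^bsub>R\<^esub> d')
          (c \<otimes>\<^bsub>R\<^esub> a' \<oplus>\<^bsub>R\<^esub> d \<otimes>\<^bsub>R\<^esub> c') (c \<otimes>\<^bsub>R\<^esub> b' \<oplus>\<^bsub>R\<^esub> d \<otimes>\<^bsub>R\<^esub> d')"

definition Aff2_group :: "('r, 'n) ring_scheme \<Rightarrow> 'r mat2 monoid" where
  "Aff2_group R =
    \<lparr>carrier = {Mat2 \<one>\<^bsub>R\<^esub> x \<zero>\<^bsub>R\<^esub> t | x t. x \<in> carrier R \<and> t \<in> Units R},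
     monoid.mult = mat2_mult R,
     one = Mat2 \<one>\<^bsub>R\<^esub> \<zero>\<^bsub>R\<^esub> \<zero>\<^bsub>R\<^esub> \<one>\<^bsub>R\<^esub>\<rparr>"

definition Aff2_functor :: "('f, 'r, 'r mat2) gfunctor" where
  "Aff2_functor = \<lparr>gobj = Aff2_group, gmap = (\<lambda>R S f. map_mat2 f)\<rparr>"

end

theory Submission
  imports Defs "HOL-Decision_Procs.Commutative_Ring" "HOL-Library.Reflection"
begin

text \<open>
  Let \<open>V\<close> be free of rank two with basis \<open>u, v\<close>. When \<open>3\<close> is invertible, \<open>W\<^sub>2\<close> is the space of
  commutative multiplications on \<open>V\<close>, with the product
  \<open>(A * B)(x, y) = A(u, B(x, y)) - B(A(u, x), y) - B(x, A(u, y))\<close>, the derivative of \<open>B\<close> along the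
  endomorphism \<open>A(u, _)\<close>. For example \<open>e\<^sub>2\<close> sends \<open>(u, u)\<close> to \<open>v\<close> and the other pairs of basis
  vectors to \<open>0\<close>, and \<open>e\<^sub>4\<close> sends \<open>(v, v)\<close> to \<open>u\<close>. Only the vector \<open>u\<close> enters the product, so the
  stabilizer of \<open>u\<close> in \<open>GL(V)\<close> acts by automorphisms. It consists of the matrices with columns
  \<open>(1, 0)\<close> and \<open>(y, t)\<close>, that is, of \<open>Aff\<^sub>2\<close>. The theorem says that nothing else acts, over every
  commutative \<open>F\<close>-algebra \<open>R\<close>, including those with nilpotents or zero divisors.

  The action is written down directly, as a torus (\<open>torus_alg_iso\<close>) followed by a unipotent
  one-parameter group (\<open>unip_alg_iso\<close>). Such an automorphism sends \<open>e\<^sub>2\<close> to an element whose first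
  two coordinates are \<open>y\<close> and \<open>t\<close>. Conversely let \<open>\<phi>\<close> be an automorphism and \<open>b = \<phi> e\<^sub>2\<close>. The
  elements annihilating \<open>W\<^sub>2\<close> from the left form the plane \<open>K\<close> spanned by \<open>e\<^sub>3 + e\<^sub>6\<close> and \<open>e\<^sub>4\<close>,
  which \<open>\<phi>\<close> preserves. Hence \<open>\<phi> e\<^sub>3 = b (\<phi> e\<^sub>4)\<close> lies in \<open>K\<close> modulo \<open>b\<^sub>2\<close>; since \<open>e\<^sub>3\<close> is not in
  \<open>K\<close> modulo any proper ideal, \<open>b\<^sub>2\<close> is a unit (\<open>alg_iso_w2_unit\<close>). Given this, the equation
  \<open>b b = 0\<close> determines all coordinates of \<open>b\<close> from \<open>b\<^sub>1\<close> and \<open>b\<^sub>2\<close> and puts \<open>b\<close> in the orbit of \<open>e\<^sub>2\<close>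
  under \<open>Aff\<^sub>2\<close> (\<open>alg_iso_w2_eq\<close>). After composing with an element of \<open>Aff\<^sub>2\<close> one may assume that
  \<open>\<phi> e\<^sub>2 = e\<^sub>2\<close>, and then \<open>\<phi>\<close> is the identity (\<open>alg_iso_fixing_w2\<close>). No step divides by \<open>2\<close>, so
  characteristic two is covered.

  All of this takes place in the coordinate algebra \<open>W2 R\<close>, which has the same structure constants
  over \<open>R\<close>. The tensor product \<open>W\<^sub>2 \<otimes>\<^sub>F R\<close> is identified with it naturally in \<open>R\<close>
  (\<open>fiber_alg_iso\<close>, \<open>base_change_map_fiber\<close>): the bilinear map \<open>(w, r) \<mapsto> r w\<close> extends to the free
  abelian group on the pairs, and the kernel of the extension is generated by the tensor relations,
  because every class contains a combination of the \<open>e\<^sub>i \<otimes> v\<^sub>i\<close>. Thus the tensors are exactly the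
  fibers of the extension. Finally an isomorphism of groups for each \<open>R\<close> that commutes with the
  transition maps carries the functor laws from \<open>Aff\<^sub>2\<close> to the automorphism functor
  (\<open>group_functor_isomorphic_transport\<close>).
\<close>

text \<open>
  Coordinates are numbered \<open>1, \<dots>, 6\<close>; rewriting \<open>1\<close> to \<open>Suc 0\<close> would hide the first one from the
  simplification rules about coordinates.
\<close>

declare One_nat_def [simp del]

section \<open>Polynomial identities in commutative rings\<close>

text \<open>
  Identities between polynomial expressions in a ring given by its carrier are proved by reflection:
  both sides are read as expressions of type \<^typ>\<open>polex\<close> and compared in normal form. Variables
  are looked up by \<open>!\<close> because reification produces a list of atoms indexed in this way, whereas
  the correctness theorem of the normal form is about \<open>head (drop n l)\<close>. The two agree only below
  the length of the list, which is what the bound expresses.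
\<close>

fun polex_bound :: "nat \<Rightarrow> polex \<Rightarrow> bool" where
  "polex_bound n (Var i) \<longleftrightarrow> i < n"
| "polex_bound n (Const c) \<longleftrightarrow> True"
| "polex_bound n (Add P Q) \<longleftrightarrow> polex_bound n P \<and> polex_bound n Q"
| "polex_bound n (Sub P Q) \<longleftrightarrow> polex_bound n P \<and> polex_bound n Q"
| "polex_bound n (Mul P Q) \<longleftrightarrow> polex_bound n P \<and> polex_bound n Q"
| "polex_bound n (Pow P k) \<longleftrightarrow> polex_bound n P"
| "polex_bound n (Neg P) \<longleftrightarrow> polex_bound n P"

context cring
begin

primrec peval :: "polex \<Rightarrow> 'a list \<Rightarrow> 'a" where
  "peval (Var n) l = l ! n"
| "peval (Const i) l = \<guillemotleft>i\<guillemotright>"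
| "peval (Add P Q) l = peval P l \<oplus> peval Q l"
| "peval (Sub P Q) l = peval P l \<ominus> peval Q l"
| "peval (Mul P Q) l = peval P l \<otimes> peval Q l"
| "peval (Pow P n) l = peval P l [^] n"
| "peval (Neg P) l = \<ominus> peval P l"

fun polex_eq :: "polex \<times> polex \<Rightarrow> 'a list \<Rightarrow> bool" where
  "polex_eq (P, Q) l \<longleftrightarrow> peval P l = peval Q l"

lemma peval_Const: "peval (Const 0) l = \<zero>" "peval (Const 1) l = \<one>"
  by simp_all

lemmas polex_reify = polex_eq.simps peval_Const peval.simps

lemma peval_eq_Ipolex: "polex_bound (length l) P \<Longrightarrow> peval P l = Ipolex l P"
proof (induct P)
  case (Var n)
  then show ?case by (simp add: Cons_nth_drop_Suc[symmetric])
qed simp_all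

lemma polex_eqI:
  assumes "norm P = norm Q" "polex_bound (length l) P" "polex_bound (length l) Q"
    and "set l \<subseteq> carrier R"
  shows "polex_eq (P, Q) l"
  using norm_eq[of l P Q] assms by (auto simp: peval_eq_Ipolex in_carrier_def)

lemmas polex_norm = sub_def mkPX_def mkPinj_def

end

section \<open>Coordinates on \<open>W\<^sub>2\<close>\<close>

text \<open>
  Most of the computation takes place on explicit vectors; \<open>k - 1\<close> turns the coordinates \<open>1\<close> to \<open>6\<close>
  into list positions.
\<close>

definition vec6 :: "'a \<Rightarrow> 'a \<Rightarrow> 'a \<Rightarrow> 'a \<Rightarrow> 'a \<Rightarrow> 'a \<Rightarrow> nat \<Rightarrow> 'a" where
  "vec6 a b c d e f = (\<lambda>k\<in>{1..6}. [a, b, c, d, e, f] ! (k - 1))"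

lemma atLeastAtMost_1_6: "{1..6} = {1, 2, 3, 4, 5, 6::nat}"
  by auto

lemma Ball_1_6: "(\<forall>k\<in>{1..6::nat}. P k) \<longleftrightarrow> P 1 \<and> P 2 \<and> P 3 \<and> P 4 \<and> P 5 \<and> P 6"
  by (simp add: atLeastAtMost_1_6)

lemma vec6_nth [simp]:
  "vec6 a b c d e f 1 = a" "vec6 a b c d e f 2 = b" "vec6 a b c d e f 3 = c"
  "vec6 a b c d e f 4 = d" "vec6 a b c d e f 5 = e" "vec6 a b c d e f 6 = f"
  by (simp_all add: vec6_def)

lemma W2_carrier_iff:
  "x \<in> carrier (W2 R) \<longleftrightarrow> x \<in> extensional {1..6} \<and>
     x 1 \<in> carrier R \<and> x 2 \<in> carrier R \<and> x 3 \<in> carrier R \<and>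
     x 4 \<in> carrier R \<and> x 5 \<in> carrier R \<and> x 6 \<in> carrier R"
  by (auto simp: W2_def PiE_iff Ball_1_6)

lemma W2_coord:
  assumes "x \<in> carrier (W2 R)"
  shows "x 1 \<in> carrier R" "x 2 \<in> carrier R" "x 3 \<in> carrier R"
    "x 4 \<in> carrier R" "x 5 \<in> carrier R" "x 6 \<in> carrier R"
  using assms unfolding W2_carrier_iff by blast+

lemma W2_coord_closed: "x \<in> carrier (W2 R) \<Longrightarrow> k \<in> {1..6} \<Longrightarrow> x k \<in> carrier R"
  by (simp add: W2_def PiE_iff)

lemma vec6_extensional [simp]: "vec6 a b c d e f \<in> extensional {1..6}"
  by (simp add: vec6_def)

lemma vec6_in_W2 [simp]:
  "vec6 a b c d e f \<in> carrier (W2 R) \<longleftrightarrow> a \<in> carrier R \<and> b \<in> carrier R \<and>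
     c \<in> carrier R \<and> d \<in> carrier R \<and> e \<in> carrier R \<and> f \<in> carrier R"
  by (simp add: W2_carrier_iff)

lemma W2_eqI:
  fixes x y :: "nat \<Rightarrow> 'a"
  assumes "x \<in> extensional {1..6}" "y \<in> extensional {1..6}"
    and "x 1 = y 1" "x 2 = y 2" "x 3 = y 3" "x 4 = y 4" "x 5 = y 5" "x 6 = y 6"
  shows "x = y"
proof (rule extensionalityI[of x "{1..6}" y])
  have "\<forall>k\<in>{1..6}. x k = y k"
    using assms by (simp add: Ball_1_6)
  then show "x k = y k" if "k \<in> {1..6}" for k
    using that by blast
qed (use assms in auto)

lemma W2_carrier_extensional: "x \<in> carrier (W2 R) \<Longrightarrow> x \<in> extensional {1..6}"
  by (simp add: W2_carrier_iff)

lemma W2_extensional [simp]: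
  "x \<oplus>\<^bsub>W2 R\<^esub> y \<in> extensional {1..6}" "x \<otimes>\<^bsub>W2 R\<^esub> y \<in> extensional {1..6}"
  "s \<odot>\<^bsub>W2 R\<^esub> x \<in> extensional {1..6}" "\<zero>\<^bsub>W2 R\<^esub> \<in> extensional {1..6}"
  by (simp_all add: W2_def)

lemma W2_linear_coords [simp]:
  assumes "k \<in> {1..6}"
  shows "(x \<oplus>\<^bsub>W2 R\<^esub> y) k = x k \<oplus>\<^bsub>R\<^esub> y k" "(s \<odot>\<^bsub>W2 R\<^esub> x) k = s \<otimes>\<^bsub>R\<^esub> x k"
    "\<zero>\<^bsub>W2 R\<^esub> k = \<zero>\<^bsub>R\<^esub>"
  using assms by (simp_all add: W2_def)

context cring
begin

lemma add_pow_eq_of_integer: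
  fixes k :: int
  assumes "x \<in> carrier R"
  shows "[k] \<cdot> x = \<guillemotleft>k\<guillemotright> \<otimes> x"
proof -
  have nat: "[n] \<cdot> x = \<guillemotleft>int n\<guillemotright> \<otimes> x" for n :: nat
    by (induct n) (use assms in \<open>simp_all add: l_distr a_comm\<close>)
  show ?thesis
  proof (cases "0 \<le> k")
    case True
    then show ?thesis
      by (simp only: add_pow_int_ge nat int_nat_eq if_True)
  next
    case False
    then have "[k] \<cdot> x = \<ominus> (\<guillemotleft>- k\<guillemotright> \<otimes> x)"
      using nat[of "nat (- k)"] by (simp only: add_pow_int_lt nat int_nat_eq not_le) simp
    then show ?thesis
      using assms by (simp add: l_minus)
  qed
qed

lemma finsum_1_6:
  assumes "\<And>k. k \<in> {1..6} \<Longrightarrow> f k \<in> carrier R"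
  shows "(\<Oplus>k\<in>{1..6::nat}. f k) = f 1 \<oplus> f 2 \<oplus> f 3 \<oplus> f 4 \<oplus> f 5 \<oplus> f 6"
  unfolding atLeastAtMost_1_6 using assms by (simp add: a_ac)

text \<open>
  All later computations in \<open>W\<^sub>2\<close> use these six bilinear forms in place of the structure constants.
\<close>

lemma W2_mult_coords:
  assumes "x \<in> carrier (W2 R)" "y \<in> carrier (W2 R)"
  shows "(x \<otimes>\<^bsub>W2 R\<^esub> y) 1 = \<guillemotleft>2\<guillemotright> \<otimes> x 2 \<otimes> y 3 \<oplus> x 6 \<otimes> y 2 \<ominus> x 3 \<otimes> y 2 \<ominus> x 1 \<otimes> y 1 \<ominus> \<guillemotleft>2\<guillemotright> \<otimes> x 5 \<otimes> y 1"
    "(x \<otimes>\<^bsub>W2 R\<^esub> y) 2 = \<guillemotleft>3\<guillemotright> \<otimes> x 2 \<otimes> y 1 \<ominus> \<guillemotleft>3\<guillemotright> \<otimes> x 1 \<otimes> y 2 \<ominus> \<guillemotleft>3\<guillemotright> \<otimes> x 5 \<otimes> y 2"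
    "(x \<otimes>\<^bsub>W2 R\<^esub> y) 3 = x 1 \<otimes> y 3 \<oplus> x 2 \<otimes> y 4 \<oplus> \<guillemotleft>2\<guillemotright> \<otimes> x 6 \<otimes> y 1 \<ominus> \<guillemotleft>2\<guillemotright> \<otimes> x 3 \<otimes> y 1 \<ominus> x 5 \<otimes> y 3"
    "(x \<otimes>\<^bsub>W2 R\<^esub> y) 4 = \<guillemotleft>3\<guillemotright> \<otimes> x 1 \<otimes> y 4 \<oplus> \<guillemotleft>3\<guillemotright> \<otimes> x 6 \<otimes> y 3 \<ominus> \<guillemotleft>3\<guillemotright> \<otimes> x 3 \<otimes> y 3"
    "(x \<otimes>\<^bsub>W2 R\<^esub> y) 5 = \<ominus> (x 1 \<otimes> y 5) \<ominus> x 2 \<otimes> y 6 \<ominus> \<guillemotleft>2\<guillemotright> \<otimes> x 5 \<otimes> y 5"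
    "(x \<otimes>\<^bsub>W2 R\<^esub> y) 6 = x 1 \<otimes> y 6 \<oplus> x 3 \<otimes> y 5 \<ominus> x 6 \<otimes> y 5 \<ominus> x 5 \<otimes> y 6"
proof -
  have c: "x i \<in> carrier R" "y i \<in> carrier R" if "i \<in> {1..6}" for i
    using W2_coord_closed[OF assms(1) that] W2_coord_closed[OF assms(2) that] by simp_all
  \<comment> \<open>abstracting the six-term sum keeps the 36 products folded until the table is evaluated\<close>
  define S where "S f = f 1 \<oplus> f 2 \<oplus> f 3 \<oplus> f 4 \<oplus> f 5 \<oplus> f (6::nat)" for f
  define t where "t k i j = \<guillemotleft>W2_const i j k\<guillemotright> \<otimes> (x i \<otimes> y j)" for k i j
  have t: "t k i j \<in> carrier R" if "i \<in> {1..6}" "j \<in> {1..6}" for i j k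
    unfolding t_def using c(1)[OF that(1)] c(2)[OF that(2)] by simp
  have S: "(\<Oplus>i\<in>{1..6}. f i) = S f" if "\<And>i. i \<in> {1..6} \<Longrightarrow> f i \<in> carrier R" for f
    unfolding S_def using that by (rule finsum_1_6)
  have S_closed: "S f \<in> carrier R" if "\<And>i. i \<in> {1..6} \<Longrightarrow> f i \<in> carrier R" for f
    using that by (simp add: S_def)
  have **: "(x \<otimes>\<^bsub>W2 R\<^esub> y) k = S (\<lambda>i. S (t k i))" if k: "k \<in> {1..6}" for k
  proof -
    have inner: "(\<Oplus>j\<in>{1..6}. [W2_const i j k] \<cdot> (x i \<otimes> y j)) = S (t k i)" if i: "i \<in> {1..6}" for i
    proof -
      have "(\<Oplus>j\<in>{1..6}. [W2_const i j k] \<cdot> (x i \<otimes> y j)) = (\<Oplus>j\<in>{1..6}. t k i j)"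
      proof (rule finsum_cong')
        fix j :: nat assume "j \<in> {1..6}"
        then show "[W2_const i j k] \<cdot> (x i \<otimes> y j) = t k i j"
          using c(1)[OF i] c(2) by (simp only: t_def add_pow_eq_of_integer m_closed)
      qed (use t[OF i] in simp_all)
      also have "\<dots> = S (t k i)"
        by (rule S) (rule t[OF i])
      finally show ?thesis .
    qed
    have "(x \<otimes>\<^bsub>W2 R\<^esub> y) k = (\<Oplus>i\<in>{1..6}. \<Oplus>j\<in>{1..6}. [W2_const i j k] \<cdot> (x i \<otimes> y j))"
      using k by (simp add: W2_def)
    also have "\<dots> = (\<Oplus>i\<in>{1..6}. S (t k i))"
    proof (rule finsum_cong')
      show "(\<lambda>i. S (t k i)) \<in> {1..6} \<rightarrow> carrier R"
        by (intro Pi_I S_closed t)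
    qed (simp_all only: inner)
    also have "\<dots> = S (\<lambda>i. S (t k i))"
      by (rule S) (simp only: S_closed t)
    finally show ?thesis .
  qed
  note [simp] = W2_coord[OF assms(1)] W2_coord[OF assms(2)]
  note s = S_def t_def W2_const_def W2_table_def
  show "(x \<otimes>\<^bsub>W2 R\<^esub> y) 1 = \<guillemotleft>2\<guillemotright> \<otimes> x 2 \<otimes> y 3 \<oplus> x 6 \<otimes> y 2 \<ominus> x 3 \<otimes> y 2 \<ominus> x 1 \<otimes> y 1 \<ominus> \<guillemotleft>2\<guillemotright> \<otimes> x 5 \<otimes> y 1"
    by (simp add: ** s,
      reify polex_reify, rule polex_eqI, simp add: polex_norm, simp, simp, simp)
  show "(x \<otimes>\<^bsub>W2 R\<^esub> y) 2 = \<guillemotleft>3\<guillemotright> \<otimes> x 2 \<otimes> y 1 \<ominus> \<guillemotleft>3\<guillemotright> \<otimes> x 1 \<otimes> y 2 \<ominus> \<guillemotleft>3\<guillemotright> \<otimes> x 5 \<otimes> y 2"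
    by (simp add: ** s,
      reify polex_reify, rule polex_eqI, simp add: polex_norm, simp, simp, simp)
  show "(x \<otimes>\<^bsub>W2 R\<^esub> y) 3 = x 1 \<otimes> y 3 \<oplus> x 2 \<otimes> y 4 \<oplus> \<guillemotleft>2\<guillemotright> \<otimes> x 6 \<otimes> y 1 \<ominus> \<guillemotleft>2\<guillemotright> \<otimes> x 3 \<otimes> y 1 \<ominus> x 5 \<otimes> y 3"
    by (simp add: ** s,
      reify polex_reify, rule polex_eqI, simp add: polex_norm, simp, simp, simp)
  show "(x \<otimes>\<^bsub>W2 R\<^esub> y) 4 = \<guillemotleft>3\<guillemotright> \<otimes> x 1 \<otimes> y 4 \<oplus> \<guillemotleft>3\<guillemotright> \<otimes> x 6 \<otimes> y 3 \<ominus> \<guillemotleft>3\<guillemotright> \<otimes> x 3 \<otimes> y 3"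
    by (simp add: ** s,
      reify polex_reify, rule polex_eqI, simp add: polex_norm, simp, simp, simp)
  show "(x \<otimes>\<^bsub>W2 R\<^esub> y) 5 = \<ominus> (x 1 \<otimes> y 5) \<ominus> x 2 \<otimes> y 6 \<ominus> \<guillemotleft>2\<guillemotright> \<otimes> x 5 \<otimes> y 5"
    by (simp add: ** s,
      reify polex_reify, rule polex_eqI, simp add: polex_norm, simp, simp, simp)
  show "(x \<otimes>\<^bsub>W2 R\<^esub> y) 6 = x 1 \<otimes> y 6 \<oplus> x 3 \<otimes> y 5 \<ominus> x 6 \<otimes> y 5 \<ominus> x 5 \<otimes> y 6"
    by (simp add: ** s,
      reify polex_reify, rule polex_eqI, simp add: polex_norm, simp, simp, simp)
qed

lemma W2_smult_closed [simp]:
  assumes "s \<in> carrier R" "x \<in> carrier (W2 R)"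
  shows "s \<odot>\<^bsub>W2 R\<^esub> x \<in> carrier (W2 R)"
  using assms by (simp add: W2_carrier_iff)

lemma W2_add_closed [simp]:
  assumes "x \<in> carrier (W2 R)" "y \<in> carrier (W2 R)"
  shows "x \<oplus>\<^bsub>W2 R\<^esub> y \<in> carrier (W2 R)"
  using assms by (simp add: W2_carrier_iff)

lemma W2_mult_closed [simp]:
  assumes "x \<in> carrier (W2 R)" "y \<in> carrier (W2 R)"
  shows "x \<otimes>\<^bsub>W2 R\<^esub> y \<in> carrier (W2 R)"
  using W2_coord[OF assms(1)] W2_coord[OF assms(2)]
  by (subst W2_carrier_iff) (simp add: W2_mult_coords[OF assms])

lemma W2_zero_closed [simp]: "\<zero>\<^bsub>W2 R\<^esub> \<in> carrier (W2 R)"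
  by (simp add: W2_carrier_iff)

lemma W2_abelian_group: "abelian_group (W2 R)"
proof (rule abelian_groupI)
  fix x y z assume "x \<in> carrier (W2 R)" "y \<in> carrier (W2 R)" "z \<in> carrier (W2 R)"
  then show "x \<oplus>\<^bsub>W2 R\<^esub> y \<oplus>\<^bsub>W2 R\<^esub> z = x \<oplus>\<^bsub>W2 R\<^esub> (y \<oplus>\<^bsub>W2 R\<^esub> z)"
    by (intro W2_eqI) (simp_all add: W2_carrier_iff a_assoc)
next
  fix x y assume "x \<in> carrier (W2 R)" "y \<in> carrier (W2 R)"
  then show "x \<oplus>\<^bsub>W2 R\<^esub> y = y \<oplus>\<^bsub>W2 R\<^esub> x"
    by (intro W2_eqI) (simp_all add: W2_carrier_iff a_comm)
next
  fix x assume x: "x \<in> carrier (W2 R)"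
  then show "\<zero>\<^bsub>W2 R\<^esub> \<oplus>\<^bsub>W2 R\<^esub> x = x"
    by (intro W2_eqI) (simp_all add: W2_carrier_iff)
  show "\<exists>y\<in>carrier (W2 R). y \<oplus>\<^bsub>W2 R\<^esub> x = \<zero>\<^bsub>W2 R\<^esub>"
  proof (rule bexI)
    show "(\<ominus> \<one>) \<odot>\<^bsub>W2 R\<^esub> x \<oplus>\<^bsub>W2 R\<^esub> x = \<zero>\<^bsub>W2 R\<^esub>"
      using x by (intro W2_eqI) (simp_all add: W2_carrier_iff l_minus l_neg)
  qed (simp add: x)
qed simp_all

lemma W2_mult_add_left:
  assumes "x \<in> carrier (W2 R)" "y \<in> carrier (W2 R)" "z \<in> carrier (W2 R)"
  shows "(x \<oplus>\<^bsub>W2 R\<^esub> y) \<otimes>\<^bsub>W2 R\<^esub> z = x \<otimes>\<^bsub>W2 R\<^esub> z \<oplus>\<^bsub>W2 R\<^esub> y \<otimes>\<^bsub>W2 R\<^esub> z"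
proof -
  note [simp] = assms W2_coord[OF assms(1)] W2_coord[OF assms(2)] W2_coord[OF assms(3)]
  show ?thesis
    by (rule W2_eqI, simp_all only: W2_extensional, simp_all add: W2_mult_coords)
      (reify polex_reify, rule polex_eqI, simp add: polex_norm, simp, simp, simp)+
qed

lemma W2_mult_add_right:
  assumes "x \<in> carrier (W2 R)" "y \<in> carrier (W2 R)" "z \<in> carrier (W2 R)"
  shows "z \<otimes>\<^bsub>W2 R\<^esub> (x \<oplus>\<^bsub>W2 R\<^esub> y) = z \<otimes>\<^bsub>W2 R\<^esub> x \<oplus>\<^bsub>W2 R\<^esub> z \<otimes>\<^bsub>W2 R\<^esub> y"
proof -
  note [simp] = assms W2_coord[OF assms(1)] W2_coord[OF assms(2)] W2_coord[OF assms(3)]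
  show ?thesis
    by (rule W2_eqI, simp_all only: W2_extensional, simp_all add: W2_mult_coords)
      (reify polex_reify, rule polex_eqI, simp add: polex_norm, simp, simp, simp)+
qed

lemma W2_smult_mult_smult:
  assumes "x \<in> carrier (W2 R)" "y \<in> carrier (W2 R)" "r \<in> carrier R" "s \<in> carrier R"
  shows "(r \<odot>\<^bsub>W2 R\<^esub> x) \<otimes>\<^bsub>W2 R\<^esub> (s \<odot>\<^bsub>W2 R\<^esub> y) = (r \<otimes> s) \<odot>\<^bsub>W2 R\<^esub> (x \<otimes>\<^bsub>W2 R\<^esub> y)"
proof -
  note [simp] = assms W2_coord[OF assms(1)] W2_coord[OF assms(2)]
  show ?thesis
    by (rule W2_eqI, simp_all only: W2_extensional, simp_all add: W2_mult_coords)
      (reify polex_reify, rule polex_eqI, simp add: polex_norm, simp, simp, simp)+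
qed

end

section \<open>Isomorphisms of algebras and their automorphism groups\<close>

text \<open>
  Unlike \<^const>\<open>alg_auto\<close>, this leaves the values outside the carrier open, so that isomorphisms can
  be composed and inverted as plain functions.
\<close>

definition alg_iso :: "('r, 'n) ring_scheme \<Rightarrow> ('r, 'a) module \<Rightarrow> ('r, 'b) module \<Rightarrow> ('a \<Rightarrow> 'b) set" where
  "alg_iso R A B =
     {\<phi>. bij_betw \<phi> (carrier A) (carrier B) \<and>
        (\<forall>x\<in>carrier A. \<forall>y\<in>carrier A. \<phi> (x \<oplus>\<^bsub>A\<^esub> y) = \<phi> x \<oplus>\<^bsub>B\<^esub> \<phi> y) \<and>
        (\<forall>x\<in>carrier A. \<forall>y\<in>carrier A. \<phi> (x \<otimes>\<^bsub>A\<^esub> y) = \<phi> x \<otimes>\<^bsub>B\<^esub> \<phi> y) \<and>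
        (\<forall>s\<in>carrier R. \<forall>x\<in>carrier A. \<phi> (s \<odot>\<^bsub>A\<^esub> x) = s \<odot>\<^bsub>B\<^esub> \<phi> x)}"

definition ops_closed :: "('r, 'n) ring_scheme \<Rightarrow> ('r, 'a) module \<Rightarrow> bool" where
  "ops_closed R A \<longleftrightarrow>
     (\<forall>x\<in>carrier A. \<forall>y\<in>carrier A. x \<oplus>\<^bsub>A\<^esub> y \<in> carrier A \<and> x \<otimes>\<^bsub>A\<^esub> y \<in> carrier A) \<and>
     (\<forall>s\<in>carrier R. \<forall>x\<in>carrier A. s \<odot>\<^bsub>A\<^esub> x \<in> carrier A)"

lemma alg_isoD:
  assumes "\<phi> \<in> alg_iso R A B"
  shows "bij_betw \<phi> (carrier A) (carrier B)"
    and "x \<in> carrier A \<Longrightarrow> \<phi> x \<in> carrier B"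
    and "x \<in> carrier A \<Longrightarrow> y \<in> carrier A \<Longrightarrow> \<phi> (x \<oplus>\<^bsub>A\<^esub> y) = \<phi> x \<oplus>\<^bsub>B\<^esub> \<phi> y"
    and "x \<in> carrier A \<Longrightarrow> y \<in> carrier A \<Longrightarrow> \<phi> (x \<otimes>\<^bsub>A\<^esub> y) = \<phi> x \<otimes>\<^bsub>B\<^esub> \<phi> y"
    and "s \<in> carrier R \<Longrightarrow> x \<in> carrier A \<Longrightarrow> \<phi> (s \<odot>\<^bsub>A\<^esub> x) = s \<odot>\<^bsub>B\<^esub> \<phi> x"
  using assms unfolding alg_iso_def by (auto dest: bij_betw_apply)

lemma alg_auto_iff:
  "\<phi> \<in> alg_auto R A \<longleftrightarrow> \<phi> \<in> alg_iso R A A \<and> \<phi> \<in> extensional (carrier A)"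
  unfolding alg_auto_def alg_iso_def Bij_def by blast

lemma alg_auto_closed: "\<phi> \<in> alg_auto R A \<Longrightarrow> x \<in> carrier A \<Longrightarrow> \<phi> x \<in> carrier A"
  by (auto simp: alg_auto_iff intro: alg_isoD(2))

lemma alg_iso_cong:
  assumes "\<phi> \<in> alg_iso R A B" "ops_closed R A" "\<And>x. x \<in> carrier A \<Longrightarrow> \<psi> x = \<phi> x"
  shows "\<psi> \<in> alg_iso R A B"
proof -
  have "bij_betw \<psi> (carrier A) (carrier B)"
    using assms(1,3) bij_betw_cong[of "carrier A" \<psi> \<phi>] by (simp add: alg_iso_def)
  then show ?thesis
    using assms by (simp add: alg_iso_def ops_closed_def)
qed

lemma alg_iso_comp:
  assumes \<phi>: "\<phi> \<in> alg_iso R A B" and \<psi>: "\<psi> \<in> alg_iso R B C"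
  shows "(\<lambda>x. \<psi> (\<phi> x)) \<in> alg_iso R A C"
proof -
  have "bij_betw (\<lambda>x. \<psi> (\<phi> x)) (carrier A) (carrier C)"
    using bij_betw_trans[OF alg_isoD(1)[OF \<phi>] alg_isoD(1)[OF \<psi>]] by (simp add: comp_def)
  then show ?thesis
    by (simp add: alg_iso_def alg_isoD[OF \<phi>] alg_isoD[OF \<psi>])
qed

lemma alg_iso_inv:
  assumes \<phi>: "\<phi> \<in> alg_iso R A B" and A: "ops_closed R A"
  shows "inv_into (carrier A) \<phi> \<in> alg_iso R B A"
proof -
  let ?\<psi> = "inv_into (carrier A) \<phi>"
  note bij = alg_isoD(1)[OF \<phi>]
  have mem: "?\<psi> u \<in> carrier A" and eq: "\<phi> (?\<psi> u) = u" if "u \<in> carrier B" for u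
    using bij that by (auto simp: bij_betw_def inv_into_into f_inv_into_f)
  have char: "?\<psi> u = x" if "x \<in> carrier A" "\<phi> x = u" for x u
    using bij that by (auto simp: bij_betw_def inv_into_f_f)
  show ?thesis
    unfolding alg_iso_def
    using A bij by (auto intro!: char bij_betw_inv_into simp: mem eq alg_isoD[OF \<phi>] ops_closed_def)
qed

lemma group_AlgAutoGroup:
  assumes A: "ops_closed R A"
  shows "group (AlgAutoGroup R A)"
proof -
  interpret B: group "BijGroup (carrier A)" by (rule group_BijGroup)
  have "subgroup (alg_auto R A) (BijGroup (carrier A))"
  proof (rule B.subgroupI)
    show "alg_auto R A \<subseteq> carrier (BijGroup (carrier A))"
      by (simp add: alg_auto_def BijGroup_def subset_iff)
    have "(\<lambda>x\<in>carrier A. x) \<in> alg_auto R A"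
      using A id_Bij[of "carrier A"] by (simp add: alg_auto_def ops_closed_def)
    then show "alg_auto R A \<noteq> {}" by blast
  next
    fix \<phi> assume \<phi>: "\<phi> \<in> alg_auto R A"
    then have "(\<lambda>x\<in>carrier A. inv_into (carrier A) \<phi> x) \<in> alg_iso R A A"
      by - (rule alg_iso_cong[OF alg_iso_inv[OF _ A] A], simp_all add: alg_auto_iff)
    moreover have "inv\<^bsub>BijGroup (carrier A)\<^esub> \<phi> = (\<lambda>x\<in>carrier A. inv_into (carrier A) \<phi> x)"
      using \<phi> by (intro inv_BijGroup) (simp add: alg_auto_def)
    ultimately show "inv\<^bsub>BijGroup (carrier A)\<^esub> \<phi> \<in> alg_auto R A"
      by (simp add: alg_auto_iff)
  next
    fix \<phi> \<psi> assume \<phi>\<psi>: "\<phi> \<in> alg_auto R A" "\<psi> \<in> alg_auto R A"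
    then have "compose (carrier A) \<phi> \<psi> \<in> alg_iso R A A"
      by - (rule alg_iso_cong[OF alg_iso_comp[of \<psi> R A A \<phi> A] A], simp_all add: alg_auto_iff compose_def)
    moreover have "\<phi> \<otimes>\<^bsub>BijGroup (carrier A)\<^esub> \<psi> = compose (carrier A) \<phi> \<psi>"
      using \<phi>\<psi> by (simp add: BijGroup_def alg_auto_def)
    ultimately show "\<phi> \<otimes>\<^bsub>BijGroup (carrier A)\<^esub> \<psi> \<in> alg_auto R A"
      by (simp add: alg_auto_iff)
  qed
  then show ?thesis
    unfolding AlgAutoGroup_def by (rule B.subgroup_imp_group)
qed

lemma carrier_AlgAutoGroup [simp]: "carrier (AlgAutoGroup R A) = alg_auto R A"
  by (simp add: AlgAutoGroup_def)

lemma mult_AlgAutoGroup: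
  assumes "\<phi> \<in> alg_auto R A" "\<psi> \<in> alg_auto R A"
  shows "\<phi> \<otimes>\<^bsub>AlgAutoGroup R A\<^esub> \<psi> = (\<lambda>x\<in>carrier A. \<phi> (\<psi> x))"
  using assms by (simp add: AlgAutoGroup_def BijGroup_def alg_auto_def compose_def)

definition alg_conj :: "('r, 'a) module \<Rightarrow> ('r, 'b) module \<Rightarrow> ('a \<Rightarrow> 'b) \<Rightarrow> ('a \<Rightarrow> 'a) \<Rightarrow> 'b \<Rightarrow> 'b" where
  "alg_conj A B \<eta> \<phi> = (\<lambda>u\<in>carrier B. \<eta> (\<phi> (inv_into (carrier A) \<eta> u)))"

lemma alg_conj_apply:
  assumes "\<eta> \<in> alg_iso R A B" "x \<in> carrier A"
  shows "alg_conj A B \<eta> \<phi> (\<eta> x) = \<eta> (\<phi> x)"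
  using alg_isoD(1,2)[OF assms(1)] assms(2) by (simp add: alg_conj_def bij_betw_def)

lemma ops_closed_alg_iso:
  assumes "\<eta> \<in> alg_iso R A B" "ops_closed R A"
  shows "ops_closed R B"
  unfolding ops_closed_def
proof (intro conjI ballI)
  have surj: "carrier B = \<eta> ` carrier A"
    using alg_isoD(1)[OF assms(1)] by (simp add: bij_betw_def)
  fix u assume "u \<in> carrier B"
  then obtain x where x: "x \<in> carrier A" "u = \<eta> x" by (auto simp: surj)
  {
    fix v assume "v \<in> carrier B"
    then obtain y where y: "y \<in> carrier A" "v = \<eta> y" by (auto simp: surj)
    show "u \<oplus>\<^bsub>B\<^esub> v \<in> carrier B" "u \<otimes>\<^bsub>B\<^esub> v \<in> carrier B"
      using x y assms(2) alg_isoD[OF assms(1)] by (metis ops_closed_def)+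
  }
  fix s assume "s \<in> carrier R"
  then show "s \<odot>\<^bsub>B\<^esub> u \<in> carrier B"
    using x assms(2) alg_isoD[OF assms(1)] by (metis ops_closed_def)
qed

text \<open>
  This moves the computation of automorphisms from the tensor product to coordinates.
\<close>

lemma alg_conj_iso:
  assumes \<eta>: "\<eta> \<in> alg_iso R A B" and A: "ops_closed R A"
  shows "alg_conj A B \<eta> \<in> iso (AlgAutoGroup R A) (AlgAutoGroup R B)"
proof -
  let ?\<theta> = "inv_into (carrier A) \<eta>"
  have B: "ops_closed R B" by (rule ops_closed_alg_iso[OF \<eta> A])
  have \<theta>: "?\<theta> \<in> alg_iso R B A" by (rule alg_iso_inv[OF \<eta> A])
  have \<theta>\<eta>: "?\<theta> (\<eta> x) = x" if "x \<in> carrier A" for x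
    using alg_isoD(1)[OF \<eta>] that by (simp add: bij_betw_def)
  have \<eta>\<theta>: "\<eta> (?\<theta> u) = u" if "u \<in> carrier B" for u
    using alg_isoD(1)[OF \<eta>] that by (simp add: bij_betw_def f_inv_into_f)
  have mem: "alg_conj A B \<eta> \<phi> \<in> alg_auto R B" if "\<phi> \<in> alg_auto R A" for \<phi>
  proof -
    have "(\<lambda>u. \<eta> (\<phi> (?\<theta> u))) \<in> alg_iso R B B"
      using that alg_iso_comp[OF alg_iso_comp[OF \<theta>] \<eta>] by (simp add: alg_auto_iff)
    from alg_iso_cong[OF this B] show ?thesis
      by (simp add: alg_auto_iff alg_conj_def)
  qed
  have inv_mem: "(\<lambda>x\<in>carrier A. ?\<theta> (\<psi> (\<eta> x))) \<in> alg_auto R A" if "\<psi> \<in> alg_auto R B" for \<psi>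
  proof -
    have "(\<lambda>x. ?\<theta> (\<psi> (\<eta> x))) \<in> alg_iso R A A"
      using that alg_iso_comp[OF alg_iso_comp[OF \<eta>] \<theta>] by (simp add: alg_auto_iff)
    from alg_iso_cong[OF this A] show ?thesis
      by (simp add: alg_auto_iff)
  qed
  have "bij_betw (alg_conj A B \<eta>) (alg_auto R A) (alg_auto R B)"
  proof (rule bij_betw_byWitness[where f' = "\<lambda>\<psi>. \<lambda>x\<in>carrier A. ?\<theta> (\<psi> (\<eta> x))"])
    show "\<forall>\<phi>\<in>alg_auto R A. (\<lambda>x\<in>carrier A. ?\<theta> (alg_conj A B \<eta> \<phi> (\<eta> x))) = \<phi>"
    proof
      fix \<phi> assume \<phi>: "\<phi> \<in> alg_auto R A"
      show "(\<lambda>x\<in>carrier A. ?\<theta> (alg_conj A B \<eta> \<phi> (\<eta> x))) = \<phi>"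
      proof (rule extensionalityI)
        show "\<phi> \<in> extensional (carrier A)" using \<phi> by (simp add: alg_auto_iff)
        fix x assume "x \<in> carrier A"
        then show "(\<lambda>x\<in>carrier A. ?\<theta> (alg_conj A B \<eta> \<phi> (\<eta> x))) x = \<phi> x"
          using alg_auto_closed[OF \<phi>] by (simp add: alg_conj_apply[OF \<eta>] \<theta>\<eta>)
      qed simp
    qed
    show "\<forall>\<psi>\<in>alg_auto R B. alg_conj A B \<eta> (\<lambda>x\<in>carrier A. ?\<theta> (\<psi> (\<eta> x))) = \<psi>"
    proof
      fix \<psi> assume \<psi>: "\<psi> \<in> alg_auto R B"
      show "alg_conj A B \<eta> (\<lambda>x\<in>carrier A. ?\<theta> (\<psi> (\<eta> x))) = \<psi>"
      proof (rule extensionalityI)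
        show "\<psi> \<in> extensional (carrier B)" using \<psi> by (simp add: alg_auto_iff)
        fix u assume "u \<in> carrier B"
        then show "alg_conj A B \<eta> (\<lambda>x\<in>carrier A. ?\<theta> (\<psi> (\<eta> x))) u = \<psi> u"
          using alg_auto_closed[OF \<psi>] by (simp add: alg_conj_def \<eta>\<theta> alg_isoD(2)[OF \<theta>])
      qed (simp add: alg_conj_def)
    qed
  qed (use mem inv_mem in auto)
  moreover have "alg_conj A B \<eta> \<in> hom (AlgAutoGroup R A) (AlgAutoGroup R B)"
  proof (rule homI)
    fix \<phi> \<psi> assume "\<phi> \<in> carrier (AlgAutoGroup R A)" "\<psi> \<in> carrier (AlgAutoGroup R A)"
    then have \<phi>\<psi>: "\<phi> \<in> alg_auto R A" "\<psi> \<in> alg_auto R A" by simp_all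
    show "alg_conj A B \<eta> (\<phi> \<otimes>\<^bsub>AlgAutoGroup R A\<^esub> \<psi>) =
        alg_conj A B \<eta> \<phi> \<otimes>\<^bsub>AlgAutoGroup R B\<^esub> alg_conj A B \<eta> \<psi>"
      unfolding mult_AlgAutoGroup[OF \<phi>\<psi>] mult_AlgAutoGroup[OF mem[OF \<phi>\<psi>(1)] mem[OF \<phi>\<psi>(2)]]
      by (auto simp: fun_eq_iff alg_conj_def \<theta>\<eta>
          alg_isoD(2)[OF \<theta>] alg_isoD(2)[OF \<eta>] alg_auto_closed[OF \<phi>\<psi>(2)])
  qed (simp add: mem)
  ultimately show ?thesis
    by (simp add: iso_def)
qed

section \<open>Transport of group functors\<close>

text \<open>
  Compatibility with \<open>\<Lambda>\<close> forces the map that \<open>G\<close> assigns to \<open>f\<close> to be \<open>gmap H R S f\<close> preceded by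
  the inverse of \<open>\<Lambda> R\<close> and followed by \<open>\<Lambda> S\<close>. In this form the functor laws for \<open>G\<close> reduce to
  those for \<open>H\<close>, and need not be proved from the definition of \<open>G\<close>.
\<close>

lemma group_functor_isomorphic_transport:
  fixes F :: "('f, 'm) ring_scheme"
    and G :: "('f, 'r, 'g) gfunctor" and H :: "('f, 'r, 'h) gfunctor"
  assumes H: "group_functor F H"
    and grp: "\<And>R. algebra F R \<Longrightarrow> group (gobj G R)"
    and iso: "\<And>R. algebra F R \<Longrightarrow> \<Lambda> R \<in> iso (gobj H R) (gobj G R)"
    and nat: "\<And>R S f h. algebra F R \<Longrightarrow> algebra F S \<Longrightarrow> f \<in> alg_hom F R S \<Longrightarrow>
       h \<in> carrier (gobj H R) \<Longrightarrow> gmap G R S f (\<Lambda> R h) = \<Lambda> S (gmap H R S f h)"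
  shows "group_functor_isomorphic F G H"
proof -
  define \<theta> where "\<theta> R = inv_into (carrier (gobj H R)) (\<Lambda> R)" for R
  have grpH: "group (gobj H R)" if "algebra F R" for R
    using H that by (simp add: group_functor_def)
  have homH: "gmap H R S f \<in> hom (gobj H R) (gobj H S)"
    if "algebra F R" "algebra F S" "f \<in> alg_hom F R S" for R S f
    using H that by (simp add: group_functor_def)
  have \<theta>: "\<theta> R \<in> iso (gobj G R) (gobj H R)" if "algebra F R" for R
    unfolding \<theta>_def using group.iso_set_sym[OF grpH[OF that] iso[OF that]] .
  have \<Lambda>\<theta>: "\<Lambda> R (\<theta> R g) = g" "\<theta> R g \<in> carrier (gobj H R)"
    if "algebra F R" "g \<in> carrier (gobj G R)" for R g
    using iso[OF that(1)] that(2)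
    by (auto simp: \<theta>_def iso_def bij_betw_def f_inv_into_f inv_into_into)
  have \<theta>\<Lambda>: "\<theta> R (\<Lambda> R h) = h" if "algebra F R" "h \<in> carrier (gobj H R)" for R h
    using iso[OF that(1)] that(2) by (auto simp: \<theta>_def iso_def bij_betw_def)
  have \<Lambda>_closed: "\<Lambda> R h \<in> carrier (gobj G R)"
    if "algebra F R" "h \<in> carrier (gobj H R)" for R h
  proof -
    have "\<Lambda> R \<in> hom (gobj H R) (gobj G R)"
      using iso[OF that(1)] by (simp add: iso_def)
    then show ?thesis
      using that(2) by (rule hom_in_carrier)
  qed
  have \<Lambda>_mult: "\<Lambda> R (h \<otimes>\<^bsub>gobj H R\<^esub> h') = \<Lambda> R h \<otimes>\<^bsub>gobj G R\<^esub> \<Lambda> R h'"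
    if "algebra F R" "h \<in> carrier (gobj H R)" "h' \<in> carrier (gobj H R)" for R h h'
    using iso[OF that(1)] that(2,3) by (auto simp: iso_def hom_mult)
  have \<theta>_mult: "\<theta> R (g \<otimes>\<^bsub>gobj G R\<^esub> g') = \<theta> R g \<otimes>\<^bsub>gobj H R\<^esub> \<theta> R g'"
    if "algebra F R" "g \<in> carrier (gobj G R)" "g' \<in> carrier (gobj G R)" for R g g'
    using \<theta>[OF that(1)] that(2,3) by (auto simp: iso_def hom_mult)
  have gmap: "gmap G R S f g = \<Lambda> S (gmap H R S f (\<theta> R g))"
    if "algebra F R" "algebra F S" "f \<in> alg_hom F R S" "g \<in> carrier (gobj G R)" for R S f g
    using nat[OF that(1-3) \<Lambda>\<theta>(2)[OF that(1,4)]] \<Lambda>\<theta>(1)[OF that(1,4)] by simp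
  have gmap_\<theta>: "\<theta> S (gmap G R S f g) = gmap H R S f (\<theta> R g)"
    if "algebra F R" "algebra F S" "f \<in> alg_hom F R S" "g \<in> carrier (gobj G R)" for R S f g
    using that by (simp add: gmap \<theta>\<Lambda> \<Lambda>\<theta>(2) hom_in_carrier[OF homH])
  have "group_functor F G"
    unfolding group_functor_def
  proof (intro conjI allI impI ballI)
    fix R :: "('f, 'r) module" assume R: "algebra F R"
    show "group (gobj G R)" by (rule grp[OF R])
    have id: "(\<lambda>x\<in>carrier R. x) \<in> alg_hom F R R"
    proof -
      interpret algebra F R by (rule R)
      show ?thesis by (simp add: alg_hom_def ring_hom_def Pi_iff)
    qed
    fix g assume g: "g \<in> carrier (gobj G R)"
    have "gmap H R R (\<lambda>x\<in>carrier R. x) (\<theta> R g) = \<theta> R g"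
      using H R \<Lambda>\<theta>(2)[OF R g] unfolding group_functor_def by blast
    then show "gmap G R R (\<lambda>x\<in>carrier R. x) g = g"
      by (simp only: gmap[OF R R id g] \<Lambda>\<theta>(1)[OF R g])
  next
    fix R S :: "('f, 'r) module" and f assume RS: "algebra F R" "algebra F S" "f \<in> alg_hom F R S"
    show "gmap G R S f \<in> hom (gobj G R) (gobj G S)"
    proof (rule homI)
      fix g g' assume g: "g \<in> carrier (gobj G R)" "g' \<in> carrier (gobj G R)"
      then have "g \<otimes>\<^bsub>gobj G R\<^esub> g' \<in> carrier (gobj G R)"
        by (rule monoid.m_closed[OF group.is_monoid[OF grp[OF RS(1)]]])
      then show "gmap G R S f (g \<otimes>\<^bsub>gobj G R\<^esub> g') = gmap G R S f g \<otimes>\<^bsub>gobj G S\<^esub> gmap G R S f g'"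
        using g by (simp only: gmap[OF RS] \<theta>_mult[OF RS(1)] \<Lambda>\<theta>(2)[OF RS(1)] hom_mult[OF homH[OF RS]]
            hom_in_carrier[OF homH[OF RS]] \<Lambda>_mult[OF RS(2)])
    next
      fix g assume "g \<in> carrier (gobj G R)"
      then show "gmap G R S f g \<in> carrier (gobj G S)"
        by (simp only: gmap[OF RS] \<Lambda>_closed[OF RS(2)] \<Lambda>\<theta>(2)[OF RS(1)] hom_in_carrier[OF homH[OF RS]])
    qed
  next
    fix R S T :: "('f, 'r) module" and f h g
    assume RST: "algebra F R" "algebra F S" "algebra F T" "f \<in> alg_hom F R S" "h \<in> alg_hom F S T"
      and g: "g \<in> carrier (gobj G R)"
    have hf: "compose (carrier R) h f \<in> alg_hom F R T"
    proof -
      interpret R: algebra F R by (rule RST)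
      have f: "f x \<in> carrier S" if "x \<in> carrier R" for x
        using RST(4) that ring_hom_closed[of f R S x] by (simp add: alg_hom_def)
      have "h (f x) = compose (carrier R) h f x" if "x \<in> carrier R" for x
        using that by (simp add: compose_def)
      moreover have "h \<circ> f \<in> ring_hom R T"
        using RST(4,5) ring_hom_trans[of f R S h T] by (simp add: alg_hom_def)
      ultimately have "compose (carrier R) h f \<in> ring_hom R T"
        unfolding ring_hom_def Pi_iff by simp
      then show ?thesis
        using RST(4,5) f by (simp add: alg_hom_def compose_def)
    qed
    have "gmap H R T (compose (carrier R) h f) (\<theta> R g) = gmap H S T h (gmap H R S f (\<theta> R g))"
      using H RST \<Lambda>\<theta>(2)[OF RST(1) g] unfolding group_functor_def by blast
    then show "gmap G R T (compose (carrier R) h f) g = gmap G S T h (gmap G R S f g)"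
      by (simp only: gmap[OF RST(1,3) hf g] gmap[OF RST(1,2,4) g] nat[OF RST(2,3,5)]
          hom_in_carrier[OF homH[OF RST(1,2,4)] \<Lambda>\<theta>(2)[OF RST(1) g]])
  qed
  then show ?thesis
    unfolding group_functor_isomorphic_def using H \<theta> gmap_\<theta> by blast
qed

section \<open>The automorphisms of \<open>W\<^sub>2\<close> over a commutative ring\<close>

context cring
begin

text \<open>
  These are \<open>e\<^sub>1, \<dots>, e\<^sub>6\<close> over the ring at hand.
\<close>

abbreviation "w1 \<equiv> vec6 \<one> \<zero> \<zero> \<zero> \<zero> \<zero>"
abbreviation "w2 \<equiv> vec6 \<zero> \<one> \<zero> \<zero> \<zero> \<zero>"
abbreviation "w3 \<equiv> vec6 \<zero> \<zero> \<one> \<zero> \<zero> \<zero>"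
abbreviation "w4 \<equiv> vec6 \<zero> \<zero> \<zero> \<one> \<zero> \<zero>"
abbreviation "w5 \<equiv> vec6 \<zero> \<zero> \<zero> \<zero> \<one> \<zero>"
abbreviation "w6 \<equiv> vec6 \<zero> \<zero> \<zero> \<zero> \<zero> \<one>"

lemma ops_closed_W2: "ops_closed R (W2 R)"
  by (simp add: ops_closed_def)

lemma W2_add_vec6:
  "vec6 a b c d e f \<oplus>\<^bsub>W2 R\<^esub> vec6 a' b' c' d' e' f' =
     vec6 (a \<oplus> a') (b \<oplus> b') (c \<oplus> c') (d \<oplus> d') (e \<oplus> e') (f \<oplus> f')"
  by (rule W2_eqI) simp_all

lemma W2_smult_vec6:
  "s \<odot>\<^bsub>W2 R\<^esub> vec6 a b c d e f = vec6 (s \<otimes> a) (s \<otimes> b) (s \<otimes> c) (s \<otimes> d) (s \<otimes> e) (s \<otimes> f)"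
  by (rule W2_eqI) simp_all

lemma W2_zero_vec6: "\<zero>\<^bsub>W2 R\<^esub> = vec6 \<zero> \<zero> \<zero> \<zero> \<zero> \<zero>"
  by (rule W2_eqI) simp_all

lemma W2_mult_eqI:
  assumes "x \<in> carrier (W2 R)" "y \<in> carrier (W2 R)"
    and "\<guillemotleft>2\<guillemotright> \<otimes> x 2 \<otimes> y 3 \<oplus> x 6 \<otimes> y 2 \<ominus> x 3 \<otimes> y 2 \<ominus> x 1 \<otimes> y 1 \<ominus> \<guillemotleft>2\<guillemotright> \<otimes> x 5 \<otimes> y 1 = a"
    "\<guillemotleft>3\<guillemotright> \<otimes> x 2 \<otimes> y 1 \<ominus> \<guillemotleft>3\<guillemotright> \<otimes> x 1 \<otimes> y 2 \<ominus> \<guillemotleft>3\<guillemotright> \<otimes> x 5 \<otimes> y 2 = b"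
    "x 1 \<otimes> y 3 \<oplus> x 2 \<otimes> y 4 \<oplus> \<guillemotleft>2\<guillemotright> \<otimes> x 6 \<otimes> y 1 \<ominus> \<guillemotleft>2\<guillemotright> \<otimes> x 3 \<otimes> y 1 \<ominus> x 5 \<otimes> y 3 = c"
    "\<guillemotleft>3\<guillemotright> \<otimes> x 1 \<otimes> y 4 \<oplus> \<guillemotleft>3\<guillemotright> \<otimes> x 6 \<otimes> y 3 \<ominus> \<guillemotleft>3\<guillemotright> \<otimes> x 3 \<otimes> y 3 = d"
    "\<ominus> (x 1 \<otimes> y 5) \<ominus> x 2 \<otimes> y 6 \<ominus> \<guillemotleft>2\<guillemotright> \<otimes> x 5 \<otimes> y 5 = e"
    "x 1 \<otimes> y 6 \<oplus> x 3 \<otimes> y 5 \<ominus> x 6 \<otimes> y 5 \<ominus> x 5 \<otimes> y 6 = f"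
  shows "x \<otimes>\<^bsub>W2 R\<^esub> y = vec6 a b c d e f"
  by (rule W2_eqI) (simp_all add: W2_mult_coords[OF assms(1,2)] assms(3-))

lemma three_cancel:
  assumes "\<guillemotleft>3\<guillemotright> \<otimes> x = \<guillemotleft>3\<guillemotright> \<otimes> y" "\<guillemotleft>3\<guillemotright> \<in> Units R" "x \<in> carrier R" "y \<in> carrier R"
  shows "x = y"
  using assms by (simp add: Units_l_cancel)

text \<open>
  Multiplying by \<open>e\<^sub>4\<close> gives \<open>3 a\<^sub>1\<close> and \<open>a\<^sub>2\<close>, and multiplying by \<open>e\<^sub>2\<close> gives \<open>3 a\<^sub>5\<close> and \<open>a\<^sub>6 - a\<^sub>3\<close> up
  to terms already known to vanish.
\<close>

lemma W2_annihilator_plane: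
  assumes three: "\<guillemotleft>3\<guillemotright> \<in> Units R" and a: "a \<in> carrier (W2 R)"
    and ann: "\<And>y. y \<in> carrier (W2 R) \<Longrightarrow> a \<otimes>\<^bsub>W2 R\<^esub> y = \<zero>\<^bsub>W2 R\<^esub>"
  shows "a = vec6 \<zero> \<zero> (a 3) (a 4) \<zero> (a 3)"
proof -
  note [simp] = a W2_coord[OF a]
  have 4: "(a \<otimes>\<^bsub>W2 R\<^esub> w4) k = \<zero>" and 2: "(a \<otimes>\<^bsub>W2 R\<^esub> w2) k = \<zero>" if "k \<in> {1..6}" for k
    using that by (simp_all add: ann)
  have "\<guillemotleft>3\<guillemotright> \<otimes> a 1 = \<guillemotleft>3\<guillemotright> \<otimes> \<zero>"
    using 4[of 4] by (simp add: W2_mult_coords)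
  then have a1: "a 1 = \<zero>" by (rule three_cancel) (simp_all add: three)
  have a2: "a 2 = \<zero>"
    using 4[of 3] by (simp add: W2_mult_coords)
  have "\<guillemotleft>3\<guillemotright> \<otimes> a 5 = \<guillemotleft>3\<guillemotright> \<otimes> \<zero>"
    using 2[of 2] by (simp add: W2_mult_coords a1)
  then have a5: "a 5 = \<zero>" by (rule three_cancel) (simp_all add: three)
  have "a 6 \<ominus> a 3 = \<zero>"
    using 2[of 1] by (simp add: W2_mult_coords a1 a5)
  then have "a 6 = a 3" by (simp add: eq_diff0)
  then show ?thesis
    by (intro W2_eqI) (simp_all add: W2_carrier_extensional[OF a] a1 a2 a5)
qed

lemma W2_plane_annihilates:
  assumes "p \<in> carrier R" "q \<in> carrier R" and y: "y \<in> carrier (W2 R)"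
  shows "vec6 \<zero> \<zero> p q \<zero> p \<otimes>\<^bsub>W2 R\<^esub> y = \<zero>\<^bsub>W2 R\<^esub>"
  unfolding W2_zero_vec6
  by (rule W2_mult_eqI) (use assms W2_coord[OF y] in \<open>simp_all add: minus_eq r_neg\<close>)

lemma alg_iso_zero:
  assumes "\<phi> \<in> alg_iso R (W2 R) (W2 R)"
  shows "\<phi> \<zero>\<^bsub>W2 R\<^esub> = \<zero>\<^bsub>W2 R\<^esub>"
proof -
  have *: "\<zero> \<odot>\<^bsub>W2 R\<^esub> x = \<zero>\<^bsub>W2 R\<^esub>" if "x \<in> carrier (W2 R)" for x
    using W2_coord[OF that] by (intro W2_eqI) simp_all
  show ?thesis
    using alg_isoD(5)[OF assms zero_closed W2_zero_closed] alg_isoD(2)[OF assms W2_zero_closed]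
    by (simp add: *)
qed

lemma alg_iso_annihilates:
  assumes \<phi>: "\<phi> \<in> alg_iso R (W2 R) (W2 R)" and a: "a \<in> carrier (W2 R)"
    and ann: "\<And>y. y \<in> carrier (W2 R) \<Longrightarrow> a \<otimes>\<^bsub>W2 R\<^esub> y = \<zero>\<^bsub>W2 R\<^esub>"
    and y: "y \<in> carrier (W2 R)"
  shows "\<phi> a \<otimes>\<^bsub>W2 R\<^esub> y = \<zero>\<^bsub>W2 R\<^esub>"
proof -
  obtain x where x: "x \<in> carrier (W2 R)" "y = \<phi> x"
    using alg_isoD(1)[OF \<phi>] y by (auto simp: bij_betw_def)
  then have "\<phi> a \<otimes>\<^bsub>W2 R\<^esub> y = \<phi> (a \<otimes>\<^bsub>W2 R\<^esub> x)"
    using alg_isoD(4)[OF \<phi> a] by simp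
  then show ?thesis
    using ann[OF x(1)] alg_iso_zero[OF \<phi>] by simp
qed

text \<open>
  The left annihilator is spanned by \<open>e\<^sub>3 + e\<^sub>6\<close> and \<open>e\<^sub>4\<close> and is characteristic, which cuts the image
  of any of its elements down to two unknown coordinates.
\<close>

lemma alg_iso_annihilator_image:
  assumes three: "\<guillemotleft>3\<guillemotright> \<in> Units R" and \<phi>: "\<phi> \<in> alg_iso R (W2 R) (W2 R)"
    and p: "p \<in> carrier R" and q: "q \<in> carrier R"
  defines "k \<equiv> vec6 \<zero> \<zero> p q \<zero> p"
  shows "\<phi> k = vec6 \<zero> \<zero> (\<phi> k 3) (\<phi> k 4) \<zero> (\<phi> k 3)"
proof (rule W2_annihilator_plane[OF three])
  have k: "k \<in> carrier (W2 R)" using p q by (simp add: k_def)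
  then show "\<phi> k \<in> carrier (W2 R)" by (rule alg_isoD(2)[OF \<phi>])
  fix y assume y: "y \<in> carrier (W2 R)"
  show "\<phi> k \<otimes>\<^bsub>W2 R\<^esub> y = \<zero>\<^bsub>W2 R\<^esub>"
    by (rule alg_iso_annihilates[OF \<phi> k _ y])
      (unfold k_def, rule W2_plane_annihilates[OF p q])
qed

lemma alg_iso_fixing_basis:
  assumes \<phi>: "\<phi> \<in> alg_iso R (W2 R) (W2 R)" and x: "x \<in> carrier (W2 R)"
    and "\<phi> w1 = w1" "\<phi> w2 = w2" "\<phi> w3 = w3" "\<phi> w4 = w4" "\<phi> w5 = w5" "\<phi> w6 = w6"
  shows "\<phi> x = x"
proof -
  note c [simp] = W2_coord[OF x]
  let ?s = "x 1 \<odot>\<^bsub>W2 R\<^esub> w1 \<oplus>\<^bsub>W2 R\<^esub> (x 2 \<odot>\<^bsub>W2 R\<^esub> w2 \<oplus>\<^bsub>W2 R\<^esub> (x 3 \<odot>\<^bsub>W2 R\<^esub> w3 \<oplus>\<^bsub>W2 R\<^esub>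
    (x 4 \<odot>\<^bsub>W2 R\<^esub> w4 \<oplus>\<^bsub>W2 R\<^esub> (x 5 \<odot>\<^bsub>W2 R\<^esub> w5 \<oplus>\<^bsub>W2 R\<^esub> x 6 \<odot>\<^bsub>W2 R\<^esub> w6))))"
  have s: "?s = x"
    by (rule W2_eqI) (simp_all add: W2_carrier_extensional[OF x])
  have "\<phi> ?s = ?s"
    by (simp add: alg_isoD(3,5)[OF \<phi>] assms(3-))
  then show ?thesis by (simp only: s)
qed

text \<open>
  The left annihilator leaves two unknowns each in the images of \<open>e\<^sub>4\<close> and \<open>e\<^sub>3 + e\<^sub>6\<close>. Products with
  \<open>e\<^sub>2\<close> express the images of \<open>e\<^sub>3\<close>, \<open>e\<^sub>1\<close> and \<open>e\<^sub>5\<close> through them, and a few further entries of the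
  table fix the unknowns. In the last of these, \<open>e\<^sub>5 e\<^sub>5 = -2 e\<^sub>5\<close> is used rather than
  \<open>e\<^sub>1 (e\<^sub>3 + e\<^sub>6) = e\<^sub>3 + e\<^sub>6\<close>: the latter only gives \<open>2 \<delta> = 0\<close>, which says nothing in
  characteristic two.
\<close>

lemma alg_iso_fixing_w2:
  assumes three: "\<guillemotleft>3\<guillemotright> \<in> Units R"
    and \<phi>: "\<phi> \<in> alg_iso R (W2 R) (W2 R)" and w2: "\<phi> w2 = w2" and x: "x \<in> carrier (W2 R)"
  shows "\<phi> x = x"
proof (rule alg_iso_fixing_basis[OF \<phi> x])
  note hom = alg_isoD(3-5)[OF \<phi>]
  define \<alpha> where "\<alpha> = \<phi> w4 3"
  define \<beta> where "\<beta> = \<phi> w4 4"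
  have w4: "\<phi> w4 = vec6 \<zero> \<zero> \<alpha> \<beta> \<zero> \<alpha>"
    unfolding \<alpha>_def \<beta>_def by (rule alg_iso_annihilator_image[OF three \<phi>]) simp_all
  have [simp]: "\<alpha> \<in> carrier R" "\<beta> \<in> carrier R"
    using W2_coord[OF alg_isoD(2)[OF \<phi>, of w4]] by (simp_all add: \<alpha>_def \<beta>_def)
  have "w2 \<otimes>\<^bsub>W2 R\<^esub> w4 = w3"
    by (rule W2_mult_eqI) (simp_all add: minus_eq)
  then have "\<phi> w3 = w2 \<otimes>\<^bsub>W2 R\<^esub> vec6 \<zero> \<zero> \<alpha> \<beta> \<zero> \<alpha>"
    using hom(2)[of w2 w4] by (simp add: w2 w4)
  also have "\<dots> = vec6 (\<guillemotleft>2\<guillemotright> \<otimes> \<alpha>) \<zero> \<beta> \<zero> (\<ominus> \<alpha>) \<zero>"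
    by (rule W2_mult_eqI) (simp_all add: minus_eq)
  finally have w3: "\<phi> w3 = vec6 (\<guillemotleft>2\<guillemotright> \<otimes> \<alpha>) \<zero> \<beta> \<zero> (\<ominus> \<alpha>) \<zero>" .
  have "(\<ominus> \<one>) \<odot>\<^bsub>W2 R\<^esub> (w3 \<otimes>\<^bsub>W2 R\<^esub> w2) = (\<ominus> \<one>) \<odot>\<^bsub>W2 R\<^esub> vec6 (\<ominus> \<one>) \<zero> \<zero> \<zero> \<zero> \<zero>"
    by (intro arg_cong[where f = "\<lambda>v. (\<ominus> \<one>) \<odot>\<^bsub>W2 R\<^esub> v"] W2_mult_eqI) (simp_all add: minus_eq)
  also have "\<dots> = w1" by (simp add: W2_smult_vec6 l_minus)
  finally have "\<phi> w1 = (\<ominus> \<one>) \<odot>\<^bsub>W2 R\<^esub> (\<phi> w3 \<otimes>\<^bsub>W2 R\<^esub> w2)"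
    using hom(3)[of "\<ominus> \<one>" "w3 \<otimes>\<^bsub>W2 R\<^esub> w2"] hom(2)[of w3 w2] by (simp add: w2)
  also have "\<phi> w3 \<otimes>\<^bsub>W2 R\<^esub> w2 = vec6 (\<ominus> \<beta>) (\<ominus> (\<guillemotleft>3\<guillemotright> \<otimes> \<alpha>)) \<zero> \<zero> \<zero> \<zero>"
    unfolding w3
  proof (rule W2_mult_eqI, simp_all)
    show "\<ominus> (\<guillemotleft>3\<guillemotright> \<otimes> (\<guillemotleft>2\<guillemotright> \<otimes> \<alpha>)) \<ominus> \<guillemotleft>3\<guillemotright> \<otimes> \<ominus> \<alpha> = \<ominus> (\<guillemotleft>3\<guillemotright> \<otimes> \<alpha>)"
      by (reify polex_reify, rule polex_eqI, simp add: polex_norm, simp, simp, simp)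
  qed
  finally have w1: "\<phi> w1 = vec6 \<beta> (\<guillemotleft>3\<guillemotright> \<otimes> \<alpha>) \<zero> \<zero> \<zero> \<zero>"
    by (simp add: W2_smult_vec6 l_minus)
  \<comment> \<open>the second coordinate of \<open>e\<^sub>2 e\<^sub>1 = 3 e\<^sub>2\<close> gives \<open>3 \<beta> = 3\<close>\<close>
  have "w2 \<otimes>\<^bsub>W2 R\<^esub> w1 = \<guillemotleft>3\<guillemotright> \<odot>\<^bsub>W2 R\<^esub> w2"
    unfolding W2_smult_vec6 by (rule W2_mult_eqI) (simp_all add: minus_eq)
  then have "w2 \<otimes>\<^bsub>W2 R\<^esub> \<phi> w1 = \<guillemotleft>3\<guillemotright> \<odot>\<^bsub>W2 R\<^esub> w2"
    using hom(2)[of w2 w1] hom(3)[of "\<guillemotleft>3\<guillemotright>" w2] by (simp add: w2)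
  then have "(w2 \<otimes>\<^bsub>W2 R\<^esub> \<phi> w1) 2 = (\<guillemotleft>3\<guillemotright> \<odot>\<^bsub>W2 R\<^esub> w2) 2"
    by (simp only:)
  then have "\<guillemotleft>3\<guillemotright> \<otimes> \<beta> = \<guillemotleft>3\<guillemotright> \<otimes> \<one>"
    by (simp add: w1 W2_mult_coords)
  then have \<beta>: "\<beta> = \<one>" by (rule three_cancel) (simp_all add: three)
  \<comment> \<open>the third coordinate of \<open>e\<^sub>1 e\<^sub>4 = 3 e\<^sub>4\<close> gives \<open>4 \<alpha> = 3 \<alpha>\<close>\<close>
  have "w1 \<otimes>\<^bsub>W2 R\<^esub> w4 = \<guillemotleft>3\<guillemotright> \<odot>\<^bsub>W2 R\<^esub> w4"
    unfolding W2_smult_vec6 by (rule W2_mult_eqI) (simp_all add: minus_eq)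
  then have "\<phi> w1 \<otimes>\<^bsub>W2 R\<^esub> \<phi> w4 = \<guillemotleft>3\<guillemotright> \<odot>\<^bsub>W2 R\<^esub> \<phi> w4"
    using hom(2)[of w1 w4] hom(3)[of "\<guillemotleft>3\<guillemotright>" w4] by simp
  then have "(\<phi> w1 \<otimes>\<^bsub>W2 R\<^esub> \<phi> w4) 3 = (\<guillemotleft>3\<guillemotright> \<odot>\<^bsub>W2 R\<^esub> \<phi> w4) 3"
    by (simp only:)
  then have "\<alpha> \<oplus> \<guillemotleft>3\<guillemotright> \<otimes> \<alpha> = \<guillemotleft>3\<guillemotright> \<otimes> \<alpha>"
    by (simp add: w1 w4 \<beta> W2_mult_coords)
  then have \<alpha>: "\<alpha> = \<zero>" by simp
  show w1': "\<phi> w1 = w1" and w3': "\<phi> w3 = w3" and "\<phi> w4 = w4"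
    by (simp_all add: w1 w3 w4 \<alpha> \<beta>)
  show "\<phi> w2 = w2" by (rule w2)
  let ?k = "vec6 \<zero> \<zero> \<one> \<zero> \<zero> \<one>"
  define \<gamma> where "\<gamma> = \<phi> ?k 3"
  define \<delta> where "\<delta> = \<phi> ?k 4"
  have k: "\<phi> ?k = vec6 \<zero> \<zero> \<gamma> \<delta> \<zero> \<gamma>"
    unfolding \<gamma>_def \<delta>_def by (rule alg_iso_annihilator_image[OF three \<phi>]) simp_all
  have [simp]: "\<gamma> \<in> carrier R" "\<delta> \<in> carrier R"
    using W2_coord[OF alg_isoD(2)[OF \<phi>, of ?k]] by (simp_all add: \<gamma>_def \<delta>_def)
  \<comment> \<open>the fourth coordinate of \<open>e\<^sub>3 (e\<^sub>3 + e\<^sub>6) = -3 e\<^sub>4\<close> gives \<open>3 \<gamma> = 3\<close>\<close>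
  have "w3 \<otimes>\<^bsub>W2 R\<^esub> ?k = (\<ominus> \<guillemotleft>3\<guillemotright>) \<odot>\<^bsub>W2 R\<^esub> w4"
    unfolding W2_smult_vec6 by (rule W2_mult_eqI) (simp_all add: minus_eq)
  then have "w3 \<otimes>\<^bsub>W2 R\<^esub> \<phi> ?k = (\<ominus> \<guillemotleft>3\<guillemotright>) \<odot>\<^bsub>W2 R\<^esub> w4"
    using hom(2)[of w3 ?k] hom(3)[of "\<ominus> \<guillemotleft>3\<guillemotright>" w4] by (simp add: w3' \<open>\<phi> w4 = w4\<close>)
  then have "(w3 \<otimes>\<^bsub>W2 R\<^esub> \<phi> ?k) 4 = ((\<ominus> \<guillemotleft>3\<guillemotright>) \<odot>\<^bsub>W2 R\<^esub> w4) 4"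
    by (simp only:)
  then have "\<guillemotleft>3\<guillemotright> \<otimes> \<gamma> = \<guillemotleft>3\<guillemotright> \<otimes> \<one>"
    by (simp add: k W2_mult_coords l_minus neg_equal_iff_equal)
  then have \<gamma>: "\<gamma> = \<one>" by (rule three_cancel) (simp_all add: three)
  have w2k: "w2 \<otimes>\<^bsub>W2 R\<^esub> vec6 \<zero> \<zero> \<one> d \<zero> \<one> = vec6 \<guillemotleft>2\<guillemotright> \<zero> d \<zero> (\<ominus> \<one>) \<zero>" if "d \<in> carrier R" for d
    by (rule W2_mult_eqI) (use that in \<open>simp_all add: minus_eq\<close>)
  have "w5 = \<guillemotleft>2\<guillemotright> \<odot>\<^bsub>W2 R\<^esub> w1 \<oplus>\<^bsub>W2 R\<^esub> (\<ominus> \<one>) \<odot>\<^bsub>W2 R\<^esub> (w2 \<otimes>\<^bsub>W2 R\<^esub> ?k)"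
    by (simp add: w2k W2_smult_vec6 W2_add_vec6 l_minus r_neg)
  then have "\<phi> w5 = \<guillemotleft>2\<guillemotright> \<odot>\<^bsub>W2 R\<^esub> w1 \<oplus>\<^bsub>W2 R\<^esub> (\<ominus> \<one>) \<odot>\<^bsub>W2 R\<^esub> (w2 \<otimes>\<^bsub>W2 R\<^esub> \<phi> ?k)"
    by (simp add: hom w1' w2)
  also have "\<dots> = vec6 \<zero> \<zero> (\<ominus> \<delta>) \<zero> \<one> \<zero>"
    by (simp add: k \<gamma> w2k W2_smult_vec6 W2_add_vec6 l_minus r_neg)
  finally have w5: "\<phi> w5 = vec6 \<zero> \<zero> (\<ominus> \<delta>) \<zero> \<one> \<zero>" .
  \<comment> \<open>the image of \<open>-2 e\<^sub>5\<close> has no sixth coordinate, whereas that of \<open>e\<^sub>5 e\<^sub>5\<close> is \<open>-\<delta>\<close>\<close>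
  have "w5 \<otimes>\<^bsub>W2 R\<^esub> w5 = (\<ominus> \<guillemotleft>2\<guillemotright>) \<odot>\<^bsub>W2 R\<^esub> w5"
    unfolding W2_smult_vec6 by (rule W2_mult_eqI) (simp_all add: minus_eq)
  then have "\<phi> w5 \<otimes>\<^bsub>W2 R\<^esub> \<phi> w5 = (\<ominus> \<guillemotleft>2\<guillemotright>) \<odot>\<^bsub>W2 R\<^esub> \<phi> w5"
    using hom(2)[of w5 w5] hom(3)[of "\<ominus> \<guillemotleft>2\<guillemotright>" w5] by simp
  then have "(\<phi> w5 \<otimes>\<^bsub>W2 R\<^esub> \<phi> w5) 6 = ((\<ominus> \<guillemotleft>2\<guillemotright>) \<odot>\<^bsub>W2 R\<^esub> \<phi> w5) 6"
    by (simp only:)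
  then have "\<ominus> \<delta> = \<zero>"
    by (simp add: w5 W2_mult_coords)
  then have \<delta>: "\<delta> = \<zero>"
    using minus_minus[of \<delta>] by simp
  show "\<phi> w5 = w5" by (simp add: w5 \<delta>)
  have "w6 = ?k \<oplus>\<^bsub>W2 R\<^esub> (\<ominus> \<one>) \<odot>\<^bsub>W2 R\<^esub> w3"
    by (simp add: W2_smult_vec6 W2_add_vec6 r_neg)
  then have "\<phi> w6 = \<phi> ?k \<oplus>\<^bsub>W2 R\<^esub> (\<ominus> \<one>) \<odot>\<^bsub>W2 R\<^esub> w3"
    by (simp add: hom w3')
  then show "\<phi> w6 = w6"
    by (simp add: k \<gamma> \<delta> W2_smult_vec6 W2_add_vec6 r_neg)
qed

section \<open>The action of the affine group\<close>

text \<open>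
  The action of the diagonal matrix with entries \<open>1, t\<close>; \<open>s\<close> stands for the inverse of \<open>t\<close>. It
  reflects the grading of \<open>W\<^sub>2\<close> in which \<open>e\<^sub>1, \<dots>, e\<^sub>6\<close> have degrees \<open>0, -1, 1, 2, 0, 1\<close>.
\<close>

definition torus :: "'a \<Rightarrow> 'a \<Rightarrow> (nat \<Rightarrow> 'a) \<Rightarrow> nat \<Rightarrow> 'a" where
  "torus t s x = vec6 (x 1) (t \<otimes> x 2) (s \<otimes> x 3) (s \<otimes> s \<otimes> x 4) (x 5) (s \<otimes> x 6)"

text \<open>
  The action of the unipotent matrix sending \<open>u\<close> to \<open>u\<close> and \<open>v\<close> to \<open>v + z u\<close>.
\<close>

definition unip :: "'a \<Rightarrow> (nat \<Rightarrow> 'a) \<Rightarrow> nat \<Rightarrow> 'a" where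
  "unip z x = vec6 (x 1 \<oplus> z \<otimes> x 2) (x 2)
     (\<guillemotleft>2\<guillemotright> \<otimes> z \<otimes> x 1 \<oplus> z \<otimes> z \<otimes> x 2 \<oplus> x 3)
     (\<guillemotleft>3\<guillemotright> \<otimes> z \<otimes> z \<otimes> x 1 \<oplus> z \<otimes> z \<otimes> z \<otimes> x 2 \<oplus> \<guillemotleft>3\<guillemotright> \<otimes> z \<otimes> x 3 \<oplus> x 4)
     (x 5) (x 6 \<ominus> z \<otimes> x 5)"

lemma torus_closed [simp]:
  assumes "t \<in> carrier R" "s \<in> carrier R" "x \<in> carrier (W2 R)"
  shows "torus t s x \<in> carrier (W2 R)"
  using assms W2_coord[OF assms(3)] by (simp add: torus_def)

lemma unip_closed [simp]:
  assumes "z \<in> carrier R" "x \<in> carrier (W2 R)"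
  shows "unip z x \<in> carrier (W2 R)"
  using assms W2_coord[OF assms(2)] by (simp add: unip_def)

lemma torus_torus:
  assumes "t \<in> carrier R" "s \<in> carrier R" "t \<otimes> s = \<one>" and x: "x \<in> carrier (W2 R)"
  shows "torus s t (torus t s x) = x"
proof -
  have "s \<otimes> t = \<one>" using assms(1-3) by (simp add: m_comm)
  have *: "t \<otimes> (s \<otimes> u) = u" "s \<otimes> (t \<otimes> u) = u" if "u \<in> carrier R" for u
    using that assms(1-3) \<open>s \<otimes> t = \<one>\<close> by (simp_all flip: m_assoc)
  show ?thesis
    using W2_coord[OF x] assms(1,2) W2_carrier_extensional[OF x]
    by (intro W2_eqI) (simp_all add: torus_def m_assoc *)
qed

text \<open>
  Unipotent matrices multiply by adding their parameters, so \<open>- z\<close> gives the inverse.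
\<close>

lemma unip_unip:
  assumes "z \<in> carrier R" "x \<in> carrier (W2 R)"
  shows "unip (\<ominus> z) (unip z x) = x" "unip z (unip (\<ominus> z) x) = x"
proof -
  note [simp] = assms W2_coord[OF assms(2)] W2_carrier_extensional[OF assms(2)]
  show "unip (\<ominus> z) (unip z x) = x"
    by (rule W2_eqI, simp_all add: unip_def)
      (reify polex_reify, rule polex_eqI, simp add: polex_norm, simp, simp, simp)+
  show "unip z (unip (\<ominus> z) x) = x"
    by (rule W2_eqI, simp_all add: unip_def)
      (reify polex_reify, rule polex_eqI, simp add: polex_norm, simp, simp, simp)+
qed

lemma torus_alg_iso:
  assumes t: "t \<in> carrier R" and s: "s \<in> carrier R" and ts: "t \<otimes> s = \<one>"
  shows "torus t s \<in> alg_iso R (W2 R) (W2 R)"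
proof -
  have st: "s \<otimes> t = \<one>" using t s ts by (simp add: m_comm)
  have *: "t \<otimes> (s \<otimes> u) = u" "s \<otimes> (t \<otimes> u) = u" if "u \<in> carrier R" for u
    using that t s ts st by (simp_all flip: m_assoc)
  have "bij_betw (torus t s) (carrier (W2 R)) (carrier (W2 R))"
    by (rule bij_betw_byWitness[where f' = "torus s t"])
      (use t s ts st torus_torus[of t s] torus_torus[of s t] in auto)
  moreover have "torus t s (x \<oplus>\<^bsub>W2 R\<^esub> y) = torus t s x \<oplus>\<^bsub>W2 R\<^esub> torus t s y"
    if "x \<in> carrier (W2 R)" "y \<in> carrier (W2 R)" for x y
    unfolding torus_def
    by (rule W2_eqI) (use W2_coord[OF that(1)] W2_coord[OF that(2)] t s in \<open>simp_all add: r_distr\<close>)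
  moreover have "torus t s (c \<odot>\<^bsub>W2 R\<^esub> x) = c \<odot>\<^bsub>W2 R\<^esub> torus t s x"
    if "c \<in> carrier R" "x \<in> carrier (W2 R)" for c x
    unfolding torus_def
    by (rule W2_eqI) (use W2_coord[OF that(2)] that(1) t s in \<open>simp_all add: m_ac\<close>)
  moreover have "torus t s (x \<otimes>\<^bsub>W2 R\<^esub> y) = torus t s x \<otimes>\<^bsub>W2 R\<^esub> torus t s y"
    if "x \<in> carrier (W2 R)" "y \<in> carrier (W2 R)" for x y
  proof -
    note [simp] = that W2_coord[OF that(1)] W2_coord[OF that(2)] t s
    show ?thesis
      by (rule W2_eqI)
        (simp_all add: W2_mult_coords torus_def
          minus_eq r_distr l_minus r_minus m_ac *)
  qed
  ultimately show ?thesis by (simp add: alg_iso_def)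
qed

lemma unip_alg_iso:
  assumes z [simp]: "z \<in> carrier R"
  shows "unip z \<in> alg_iso R (W2 R) (W2 R)"
proof -
  have "bij_betw (unip z) (carrier (W2 R)) (carrier (W2 R))"
    by (rule bij_betw_byWitness[where f' = "unip (\<ominus> z)"]) (auto simp: unip_unip)
  moreover have "unip z (x \<oplus>\<^bsub>W2 R\<^esub> y) = unip z x \<oplus>\<^bsub>W2 R\<^esub> unip z y"
    if "x \<in> carrier (W2 R)" "y \<in> carrier (W2 R)" for x y
  proof -
    note [simp] = W2_coord[OF that(1)] W2_coord[OF that(2)]
    show ?thesis
      unfolding unip_def
      by (rule W2_eqI, simp_all)
        (reify polex_reify, rule polex_eqI, simp add: polex_norm, simp, simp, simp)+
  qed
  moreover have "unip z (c \<odot>\<^bsub>W2 R\<^esub> x) = c \<odot>\<^bsub>W2 R\<^esub> unip z x"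
    if "c \<in> carrier R" "x \<in> carrier (W2 R)" for c x
  proof -
    note [simp] = that(1) W2_coord[OF that(2)]
    show ?thesis
      unfolding unip_def
      by (rule W2_eqI, simp_all)
        (reify polex_reify, rule polex_eqI, simp add: polex_norm, simp, simp, simp)+
  qed
  moreover have "unip z (x \<otimes>\<^bsub>W2 R\<^esub> y) = unip z x \<otimes>\<^bsub>W2 R\<^esub> unip z y"
    if "x \<in> carrier (W2 R)" "y \<in> carrier (W2 R)" for x y
  proof -
    note [simp] = that W2_coord[OF that(1)] W2_coord[OF that(2)]
    show ?thesis
      by (rule W2_eqI, simp_all add: W2_mult_coords unip_def)
        (reify polex_reify, rule polex_eqI, simp add: polex_norm, simp, simp, simp)+
  qed
  ultimately show ?thesis by (simp add: alg_iso_def)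
qed

text \<open>
  The matrix with columns \<open>(1, 0)\<close> and \<open>(y, t)\<close> is the product of the unipotent matrix with
  parameter \<open>y / t\<close> and the diagonal matrix with entries \<open>1, t\<close>.
\<close>

definition aff_auto :: "'a \<Rightarrow> 'a \<Rightarrow> (nat \<Rightarrow> 'a) \<Rightarrow> nat \<Rightarrow> 'a" where
  "aff_auto y t x = unip (inv t \<otimes> y) (torus t (inv t) x)"

lemma aff_auto_alg_iso:
  assumes "y \<in> carrier R" "t \<in> Units R"
  shows "aff_auto y t \<in> alg_iso R (W2 R) (W2 R)"
  unfolding aff_auto_def
  using assms by (intro alg_iso_comp[OF torus_alg_iso unip_alg_iso]) (simp_all add: Units_closed)

lemma aff_auto_coords:
  assumes "y \<in> carrier R" "t \<in> Units R" "x \<in> carrier (W2 R)"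
  shows "aff_auto y t x 1 = x 1 \<oplus> y \<otimes> x 2" "aff_auto y t x 2 = t \<otimes> x 2"
proof -
  have "inv t \<otimes> y \<otimes> (t \<otimes> x 2) = (inv t \<otimes> t) \<otimes> (y \<otimes> x 2)"
    using assms W2_coord[OF assms(3)] Units_closed[OF assms(2)] Units_inv_closed[OF assms(2)]
    by (simp only: m_ac m_closed)
  then show "aff_auto y t x 1 = x 1 \<oplus> y \<otimes> x 2" "aff_auto y t x 2 = t \<otimes> x 2"
    using assms W2_coord[OF assms(3)] by (simp_all add: aff_auto_def unip_def torus_def Units_closed)
qed

section \<open>Every automorphism comes from the affine group\<close>

text \<open>
  Write \<open>b = \<phi> e\<^sub>2\<close>. Since \<open>\<phi> e\<^sub>4\<close> lies in the left annihilator \<open>K\<close>, the product \<open>\<phi> e\<^sub>3 = b (\<phi> e\<^sub>4)\<close>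
  has the form \<open>k + b\<^sub>2 w\<close> with \<open>k\<close> in \<open>K\<close>. Applying the inverse of \<open>\<phi>\<close>, which also preserves \<open>K\<close>,
  gives \<open>e\<^sub>3\<close> as an element of \<open>K\<close> plus \<open>b\<^sub>2 v\<close>. Elements of \<open>K\<close> have equal third and sixth
  coordinates, so the difference of these coordinates is \<open>1 = b\<^sub>2 (v\<^sub>3 - v\<^sub>6)\<close>.
\<close>

lemma alg_iso_w2_unit:
  assumes three: "\<guillemotleft>3\<guillemotright> \<in> Units R" and \<phi>: "\<phi> \<in> alg_iso R (W2 R) (W2 R)"
  shows "\<phi> w2 2 \<in> Units R"
proof -
  define b where "b = \<phi> w2"
  have b: "b \<in> carrier (W2 R)" unfolding b_def by (rule alg_isoD(2)[OF \<phi>]) simp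
  define \<alpha> where "\<alpha> = \<phi> w4 3"
  define \<beta> where "\<beta> = \<phi> w4 4"
  have w4: "\<phi> w4 = vec6 \<zero> \<zero> \<alpha> \<beta> \<zero> \<alpha>"
    unfolding \<alpha>_def \<beta>_def by (rule alg_iso_annihilator_image[OF three \<phi>]) simp_all
  have [simp]: "\<alpha> \<in> carrier R" "\<beta> \<in> carrier R"
    using W2_coord[OF alg_isoD(2)[OF \<phi>, of w4]] by (simp_all add: \<alpha>_def \<beta>_def)
  note [simp] = b W2_coord[OF b]
  \<comment> \<open>the product of \<open>b\<close> and \<open>\<phi> e\<^sub>4\<close>, with the multiples of \<open>b\<^sub>2\<close> split off as \<open>w\<close>\<close>
  define p where "p = b 1 \<otimes> \<alpha> \<ominus> b 5 \<otimes> \<alpha>"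
  define q where "q = \<guillemotleft>3\<guillemotright> \<otimes> b 1 \<otimes> \<beta> \<oplus> \<guillemotleft>3\<guillemotright> \<otimes> b 6 \<otimes> \<alpha> \<ominus> \<guillemotleft>3\<guillemotright> \<otimes> b 3 \<otimes> \<alpha>"
  define k where "k = vec6 \<zero> \<zero> p q \<zero> p"
  define w where "w = vec6 (\<guillemotleft>2\<guillemotright> \<otimes> \<alpha>) \<zero> \<beta> \<zero> (\<ominus> \<alpha>) \<zero>"
  have [simp]: "p \<in> carrier R" "q \<in> carrier R" by (simp_all add: p_def q_def)
  have k [simp]: "k \<in> carrier (W2 R)" and w [simp]: "w \<in> carrier (W2 R)"
    by (simp_all add: k_def w_def)
  have "w2 \<otimes>\<^bsub>W2 R\<^esub> w4 = w3"
    by (rule W2_mult_eqI) (simp_all add: minus_eq)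
  then have "\<phi> w3 = b \<otimes>\<^bsub>W2 R\<^esub> vec6 \<zero> \<zero> \<alpha> \<beta> \<zero> \<alpha>"
    using alg_isoD(4)[OF \<phi>, of w2 w4] by (simp add: w4 b_def)
  also have "\<dots> = k \<oplus>\<^bsub>W2 R\<^esub> b 2 \<odot>\<^bsub>W2 R\<^esub> w"
    unfolding k_def w_def p_def q_def W2_smult_vec6 W2_add_vec6
    by (rule W2_mult_eqI, simp_all)
      (reify polex_reify, rule polex_eqI, simp add: polex_norm, simp, simp, simp)+
  finally have w3: "\<phi> w3 = k \<oplus>\<^bsub>W2 R\<^esub> b 2 \<odot>\<^bsub>W2 R\<^esub> w" .
  let ?\<psi> = "inv_into (carrier (W2 R)) \<phi>"
  have \<psi>: "?\<psi> \<in> alg_iso R (W2 R) (W2 R)"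
    by (rule alg_iso_inv[OF \<phi> ops_closed_W2])
  have "w3 = ?\<psi> (\<phi> w3)"
    using alg_isoD(1)[OF \<phi>] by (simp add: bij_betw_def)
  also have "\<dots> = ?\<psi> k \<oplus>\<^bsub>W2 R\<^esub> b 2 \<odot>\<^bsub>W2 R\<^esub> ?\<psi> w"
    by (simp add: w3 alg_isoD(3,5)[OF \<psi>])
  finally have eq: "w3 = ?\<psi> k \<oplus>\<^bsub>W2 R\<^esub> b 2 \<odot>\<^bsub>W2 R\<^esub> ?\<psi> w" .
  define c where "c = ?\<psi> k 3"
  define v where "v = ?\<psi> w"
  have "?\<psi> k = vec6 \<zero> \<zero> (?\<psi> k 3) (?\<psi> k 4) \<zero> (?\<psi> k 3)"
    unfolding k_def by (rule alg_iso_annihilator_image[OF three \<psi>]) simp_all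
  then have "?\<psi> k 6 = c" unfolding c_def by (metis vec6_nth(6))
  have [simp]: "c \<in> carrier R"
    using W2_coord[OF alg_isoD(2)[OF \<psi> k]] by (simp add: c_def)
  note [simp] = W2_coord[OF alg_isoD(2)[OF \<psi> w], folded v_def]
  have "c \<oplus> b 2 \<otimes> v 3 = \<one>"
    using arg_cong[OF eq, where f = "\<lambda>x. x 3"] by (simp add: c_def v_def)
  moreover have "c \<oplus> b 2 \<otimes> v 6 = \<zero>"
    using arg_cong[OF eq, where f = "\<lambda>x. x 6"] by (simp add: \<open>?\<psi> k 6 = c\<close> v_def)
  moreover have "b 2 \<otimes> (v 3 \<ominus> v 6) = (c \<oplus> b 2 \<otimes> v 3) \<ominus> (c \<oplus> b 2 \<otimes> v 6)"
    by (reify polex_reify, rule polex_eqI, simp add: polex_norm, simp, simp, simp)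
  ultimately have "b 2 \<otimes> (v 3 \<ominus> v 6) = \<one>"
    by (simp add: minus_eq)
  then show ?thesis
    unfolding Units_def b_def[symmetric] using m_comm[of "b 2" "v 3 \<ominus> v 6"] by (auto intro!: bexI[of _ "v 3 \<ominus> v 6"])
qed

text \<open>
  From \<open>e\<^sub>2 e\<^sub>2 = 0\<close> the coordinates of \<open>b = \<phi> e\<^sub>2\<close> satisfy \<open>b b = 0\<close>. As \<open>3\<close> and \<open>b\<^sub>2\<close> are units, the
  second and fifth coordinate of this equation give \<open>b\<^sub>5 = b\<^sub>6 = 0\<close>, and then the first and third give
  \<open>b\<^sub>2 b\<^sub>3 = b\<^sub>1 b\<^sub>1\<close> and \<open>b\<^sub>2 b\<^sub>4 = b\<^sub>1 b\<^sub>3\<close>.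
\<close>

lemma alg_iso_w2_eq:
  assumes three: "\<guillemotleft>3\<guillemotright> \<in> Units R" and \<phi>: "\<phi> \<in> alg_iso R (W2 R) (W2 R)"
  shows "\<phi> w2 = aff_auto (\<phi> w2 1) (\<phi> w2 2) w2"
proof -
  define b where "b = \<phi> w2"
  have b [simp]: "b \<in> carrier (W2 R)" unfolding b_def by (rule alg_isoD(2)[OF \<phi>]) simp
  note [simp] = W2_coord[OF b]
  have t: "b 2 \<in> Units R"
    using alg_iso_w2_unit[OF three \<phi>] by (simp add: b_def)
  define s where "s = inv (b 2)"
  have s [simp]: "s \<in> carrier R" "b 2 \<otimes> s = \<one>" "s \<otimes> b 2 = \<one>"
    using t by (simp_all add: s_def)
  have "w2 \<otimes>\<^bsub>W2 R\<^esub> w2 = \<zero>\<^bsub>W2 R\<^esub>"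
    unfolding W2_zero_vec6 by (rule W2_mult_eqI) (simp_all add: minus_eq r_neg)
  then have "b \<otimes>\<^bsub>W2 R\<^esub> b = \<zero>\<^bsub>W2 R\<^esub>"
    using alg_isoD(4)[OF \<phi>, of w2 w2] alg_iso_zero[OF \<phi>] by (simp add: b_def)
  then have E: "(b \<otimes>\<^bsub>W2 R\<^esub> b) k = \<zero>" if "k \<in> {1..6}" for k
    using that by simp
  have unit_zero: "x = \<zero>" if "u \<otimes> x = \<zero>" "u \<in> Units R" "x \<in> carrier R" for u x
    using that Units_l_cancel[of u x \<zero>] by (simp add: Units_closed)
  have "\<guillemotleft>3\<guillemotright> \<otimes> (b 2 \<otimes> b 5) = \<ominus> (\<guillemotleft>3\<guillemotright> \<otimes> b 2 \<otimes> b 1 \<ominus> \<guillemotleft>3\<guillemotright> \<otimes> b 1 \<otimes> b 2 \<ominus> \<guillemotleft>3\<guillemotright> \<otimes> b 5 \<otimes> b 2)"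
    by (reify polex_reify, rule polex_eqI, simp add: polex_norm, simp, simp, simp)
  also have "\<dots> = \<zero>"
    using E[of 2] by (simp add: W2_mult_coords)
  finally have "b 2 \<otimes> b 5 = \<zero>"
    by (rule unit_zero) (simp_all add: three)
  then have b5: "b 5 = \<zero>"
    by (rule unit_zero) (simp_all add: t)
  have "b 2 \<otimes> b 6 = \<zero>"
    using E[of 5] minus_minus[of "b 2 \<otimes> b 6"] by (simp add: W2_mult_coords b5 minus_eq)
  then have b6: "b 6 = \<zero>"
    by (rule unit_zero) (simp_all add: t)
  have "b 2 \<otimes> b 3 = (\<guillemotleft>2\<guillemotright> \<otimes> b 2 \<otimes> b 3 \<ominus> b 3 \<otimes> b 2 \<ominus> b 1 \<otimes> b 1) \<oplus> b 1 \<otimes> b 1"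
    by (reify polex_reify, rule polex_eqI, simp add: polex_norm, simp, simp, simp)
  also have "\<dots> = b 1 \<otimes> b 1"
    using E[of 1] by (simp add: W2_mult_coords b5 b6 minus_eq)
  finally have "s \<otimes> (b 2 \<otimes> b 3) = s \<otimes> (b 1 \<otimes> b 1)" by simp
  then have b3: "b 3 = s \<otimes> (b 1 \<otimes> b 1)" by (simp flip: m_assoc)
  have "b 2 \<otimes> b 4 = (b 1 \<otimes> b 3 \<oplus> b 2 \<otimes> b 4 \<ominus> \<guillemotleft>2\<guillemotright> \<otimes> b 3 \<otimes> b 1) \<oplus> b 1 \<otimes> b 3"
    by (reify polex_reify, rule polex_eqI, simp add: polex_norm, simp, simp, simp)
  also have "\<dots> = b 1 \<otimes> b 3"
    using E[of 3] by (simp add: W2_mult_coords b5 b6 minus_eq)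
  finally have "s \<otimes> (b 2 \<otimes> b 4) = s \<otimes> (b 1 \<otimes> b 3)" by simp
  then have b4: "b 4 = s \<otimes> (b 1 \<otimes> b 3)" by (simp flip: m_assoc)
  \<comment> \<open>a variable in place of \<open>b 2\<close>, so that the ordering of products puts \<open>s\<close> and \<open>t\<close> side by side\<close>
  define t where "t = b 2"
  have [simp]: "t \<in> carrier R" by (simp add: t_def)
  have *: "s \<otimes> (t \<otimes> x) = x" if "x \<in> carrier R" for x
    using that by (simp add: t_def flip: m_assoc)
  have "aff_auto (b 1) (b 2) w2 = b"
    unfolding aff_auto_def s_def[symmetric]
    by (rule W2_eqI)
      (simp_all add: W2_carrier_extensional[OF b] unip_def torus_def b5 b6 b3 b4 * m_ac minus_eq
        flip: t_def)
  then show ?thesis by (simp add: b_def)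
qed

theorem alg_iso_eq_aff_auto:
  assumes three: "\<guillemotleft>3\<guillemotright> \<in> Units R" and \<phi>: "\<phi> \<in> alg_iso R (W2 R) (W2 R)"
    and x: "x \<in> carrier (W2 R)"
  shows "\<phi> x = aff_auto (\<phi> w2 1) (\<phi> w2 2) x"
proof -
  let ?f = "aff_auto (\<phi> w2 1) (\<phi> w2 2)"
  let ?g = "inv_into (carrier (W2 R)) ?f"
  have "\<phi> w2 \<in> carrier (W2 R)" by (rule alg_isoD(2)[OF \<phi>]) simp
  then have f: "?f \<in> alg_iso R (W2 R) (W2 R)"
    by (intro aff_auto_alg_iso alg_iso_w2_unit[OF three \<phi>]) (rule W2_coord)
  have gf: "?g (?f u) = u" and fg: "?f (?g u) = u" if "u \<in> carrier (W2 R)" for u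
    using alg_isoD(1)[OF f] that by (simp_all add: bij_betw_def f_inv_into_f)
  have "(\<lambda>x. ?g (\<phi> x)) \<in> alg_iso R (W2 R) (W2 R)"
    by (rule alg_iso_comp[OF \<phi> alg_iso_inv[OF f ops_closed_W2]])
  moreover have "?g (\<phi> w2) = w2"
    by (subst alg_iso_w2_eq[OF three \<phi>], rule gf) simp
  ultimately have "?g (\<phi> x) = x"
    by (rule alg_iso_fixing_w2[OF three _ _ x])
  then show ?thesis
    using fg[OF alg_isoD(2)[OF \<phi> x]] by simp
qed

end

text \<open>
  The first column of a matrix in \<^const>\<open>Aff2_group\<close> is \<open>(1, 0)\<close>, so the second one, \<open>(y, t)\<close>,
  determines the automorphism.
\<close>

fun aff_auto_of :: "('r, 'n) ring_scheme \<Rightarrow> 'r mat2 \<Rightarrow> (nat \<Rightarrow> 'r) \<Rightarrow> nat \<Rightarrow> 'r" where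
  "aff_auto_of R (Mat2 a y c t) = (\<lambda>x\<in>carrier (W2 R). cring.aff_auto R y t x)"

text \<open>
  An automorphism is determined by the first two coordinates of the image of \<open>e\<^sub>2\<close>, which recover the
  matrix. So compatibility with products only has to be checked on these two coordinates.
\<close>

lemma (in cring) aff_auto_of_iso:
  assumes three: "\<guillemotleft>3\<guillemotright> \<in> Units R"
  shows "aff_auto_of R \<in> iso (Aff2_group R) (AlgAutoGroup R (W2 R))"
proof -
  note W = ops_closed_W2
  have closed: "(\<lambda>x\<in>carrier (W2 R). aff_auto y t x) \<in> alg_auto R (W2 R)"
    if "y \<in> carrier R" "t \<in> Units R" for y t
    using alg_iso_cong[OF aff_auto_alg_iso[OF that] W] by (simp add: alg_auto_iff)
  have mem: "Mat2 \<one> y \<zero> t \<in> carrier (Aff2_group R) \<longleftrightarrow> y \<in> carrier R \<and> t \<in> Units R" for y t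
    by (auto simp: Aff2_group_def)
  have cases: "\<exists>y t. m = Mat2 \<one> y \<zero> t \<and> y \<in> carrier R \<and> t \<in> Units R"
    if "m \<in> carrier (Aff2_group R)" for m
    using that by (auto simp: Aff2_group_def)
  have "aff_auto_of R \<in> hom (Aff2_group R) (AlgAutoGroup R (W2 R))"
  proof (rule homI)
    fix m assume "m \<in> carrier (Aff2_group R)"
    then show "aff_auto_of R m \<in> carrier (AlgAutoGroup R (W2 R))"
      using cases[of m] closed by auto
  next
    fix m m' assume "m \<in> carrier (Aff2_group R)" "m' \<in> carrier (Aff2_group R)"
    then obtain y t y' t' where m: "m = Mat2 \<one> y \<zero> t" "m' = Mat2 \<one> y' \<zero> t'"
      and c [simp]: "y \<in> carrier R" "t \<in> Units R" "y' \<in> carrier R" "t' \<in> Units R"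
      using cases[of m] cases[of m'] by blast
    let ?\<chi> = "\<lambda>x. aff_auto y t (aff_auto y' t' x)"
    have \<chi>: "?\<chi> \<in> alg_iso R (W2 R) (W2 R)"
      by (rule alg_iso_comp[OF aff_auto_alg_iso aff_auto_alg_iso]) simp_all
    have a: "aff_auto y' t' w2 \<in> carrier (W2 R)"
      by (rule alg_isoD(2)[OF aff_auto_alg_iso]) simp_all
    have "?\<chi> w2 1 = y' \<oplus> y \<otimes> t'" "?\<chi> w2 2 = t \<otimes> t'"
      using a by (simp_all add: aff_auto_coords Units_closed)
    then have "?\<chi> x = aff_auto (y' \<oplus> y \<otimes> t') (t \<otimes> t') x" if "x \<in> carrier (W2 R)" for x
      using alg_iso_eq_aff_auto[OF three \<chi> that] by simp
    then show "aff_auto_of R (m \<otimes>\<^bsub>Aff2_group R\<^esub> m') =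
        aff_auto_of R m \<otimes>\<^bsub>AlgAutoGroup R (W2 R)\<^esub> aff_auto_of R m'"
      by (auto simp: m Aff2_group_def mult_AlgAutoGroup closed fun_eq_iff
          Units_closed alg_isoD(2)[OF aff_auto_alg_iso[OF c(3,4)]])
  qed
  moreover have "bij_betw (aff_auto_of R) (carrier (Aff2_group R)) (alg_auto R (W2 R))"
  proof (rule bij_betw_byWitness[where f' = "\<lambda>\<phi>. Mat2 \<one> (\<phi> w2 1) \<zero> (\<phi> w2 2)"])
    show "\<forall>m\<in>carrier (Aff2_group R). Mat2 \<one> (aff_auto_of R m w2 1) \<zero> (aff_auto_of R m w2 2) = m"
    proof
      fix m assume "m \<in> carrier (Aff2_group R)"
      then show "Mat2 \<one> (aff_auto_of R m w2 1) \<zero> (aff_auto_of R m w2 2) = m"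
        using cases[of m] by (auto simp: aff_auto_coords Units_closed)
    qed
    show "\<forall>\<phi>\<in>alg_auto R (W2 R). aff_auto_of R (Mat2 \<one> (\<phi> w2 1) \<zero> (\<phi> w2 2)) = \<phi>"
    proof
      fix \<phi> assume \<phi>: "\<phi> \<in> alg_auto R (W2 R)"
      show "aff_auto_of R (Mat2 \<one> (\<phi> w2 1) \<zero> (\<phi> w2 2)) = \<phi>"
      proof (rule extensionalityI[of _ "carrier (W2 R)"])
        fix x assume "x \<in> carrier (W2 R)"
        then show "aff_auto_of R (Mat2 \<one> (\<phi> w2 1) \<zero> (\<phi> w2 2)) x = \<phi> x"
          using \<phi> alg_iso_eq_aff_auto[OF three, of \<phi> x] by (simp add: alg_auto_iff)
      qed (use \<phi> in \<open>simp_all add: alg_auto_iff\<close>)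
    qed
    show "aff_auto_of R ` carrier (Aff2_group R) \<subseteq> alg_auto R (W2 R)"
      using cases closed by fastforce
    show "(\<lambda>\<phi>. Mat2 \<one> (\<phi> w2 1) \<zero> (\<phi> w2 2)) ` alg_auto R (W2 R) \<subseteq> carrier (Aff2_group R)"
    proof
      fix m assume "m \<in> (\<lambda>\<phi>. Mat2 \<one> (\<phi> w2 1) \<zero> (\<phi> w2 2)) ` alg_auto R (W2 R)"
      then obtain \<phi> where \<phi>: "\<phi> \<in> alg_iso R (W2 R) (W2 R)" and m: "m = Mat2 \<one> (\<phi> w2 1) \<zero> (\<phi> w2 2)"
        by (auto simp: alg_auto_iff)
      have "\<phi> w2 \<in> carrier (W2 R)" by (rule alg_isoD(2)[OF \<phi>]) simp
      then show "m \<in> carrier (Aff2_group R)"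
        using alg_iso_w2_unit[OF three \<phi>] by (simp add: m mem W2_coord(1))
    qed
  qed
  ultimately show ?thesis by (simp add: iso_def)
qed

section \<open>Extension of scalars\<close>

definition W2_map :: "('r \<Rightarrow> 's) \<Rightarrow> (nat \<Rightarrow> 'r) \<Rightarrow> nat \<Rightarrow> 's" where
  "W2_map h x = (\<lambda>k\<in>{1..6}. h (x k))"

lemma W2_map_extensional [simp]: "W2_map h x \<in> extensional {1..6}"
  by (simp add: W2_map_def)

lemma W2_map_apply [simp]: "k \<in> {1..6} \<Longrightarrow> W2_map h x k = h (x k)"
  by (simp add: W2_map_def)

lemma ring_hom_of_integer:
  assumes "ring_hom_cring R S h"
  shows "h \<guillemotleft>n\<guillemotright>\<^bsub>R\<^esub> = \<guillemotleft>n\<guillemotright>\<^bsub>S\<^esub>"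
proof -
  interpret ring_hom_cring R S h by (rule assms)
  have nat: "h \<guillemotleft>int k\<guillemotright>\<^bsub>R\<^esub> = \<guillemotleft>int k\<guillemotright>\<^bsub>S\<^esub>" for k
    by (induct k) simp_all
  show ?thesis
    by (cases n rule: int_cases2) (simp_all add: nat)
qed

lemma W2_map_closed:
  assumes "h \<in> ring_hom R S" "x \<in> carrier (W2 R)"
  shows "W2_map h x \<in> carrier (W2 S)"
  using W2_coord[OF assms(2)] ring_hom_closed[OF assms(1)] by (simp add: W2_carrier_iff)

lemma W2_map_add:
  assumes "h \<in> ring_hom R S" and "x \<in> carrier (W2 R)" "y \<in> carrier (W2 R)"
  shows "W2_map h (x \<oplus>\<^bsub>W2 R\<^esub> y) = W2_map h x \<oplus>\<^bsub>W2 S\<^esub> W2_map h y"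
  using W2_coord[OF assms(2)] W2_coord[OF assms(3)]
  by (intro W2_eqI) (simp_all add: ring_hom_add[OF assms(1)])

lemma W2_map_mult:
  assumes R: "cring R" and S: "cring S" and h: "h \<in> ring_hom R S"
    and x: "x \<in> carrier (W2 R)" and y: "y \<in> carrier (W2 R)"
  shows "W2_map h (x \<otimes>\<^bsub>W2 R\<^esub> y) = W2_map h x \<otimes>\<^bsub>W2 S\<^esub> W2_map h y"
proof -
  interpret ring_hom_cring R S h
    using R S h by (simp add: ring_hom_cring_def ring_hom_cring_axioms_def)
  note [simp] = x y W2_coord[OF x] W2_coord[OF y] W2_map_closed[OF h x] W2_map_closed[OF h y]
  show ?thesis
    by (rule W2_eqI)
      (simp_all add: R.W2_mult_coords S.W2_mult_coords ring_hom_of_integer[OF ring_hom_cring_axioms]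
        R.minus_eq S.minus_eq)
qed

definition scalar_hom :: "('f, 'r) module \<Rightarrow> 'f \<Rightarrow> 'r" where
  "scalar_hom R a = a \<odot>\<^bsub>R\<^esub> \<one>\<^bsub>R\<^esub>"

text \<open>
  An algebra over a commutative ring, with both rings under a name of their own, since their facts
  are used side by side.
\<close>

locale scalar_extension = F: cring F + R: cring R
  for F :: "('f, 'm) ring_scheme" and R :: "('f, 'r) module" +
  assumes algebra: "algebra F R"
begin

lemma smult_closed [simp]: "a \<in> carrier F \<Longrightarrow> r \<in> carrier R \<Longrightarrow> a \<odot>\<^bsub>R\<^esub> r \<in> carrier R"
  using algebra by (intro module.smult_closed[of F R]) (simp_all add: algebra_def)

lemma scalar_hom_closed [simp]: "a \<in> carrier F \<Longrightarrow> scalar_hom R a \<in> carrier R"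
  by (simp add: scalar_hom_def)

lemma scalar_hom_smult:
  assumes "a \<in> carrier F" "r \<in> carrier R"
  shows "a \<odot>\<^bsub>R\<^esub> r = r \<otimes>\<^bsub>R\<^esub> scalar_hom R a"
proof -
  have "a \<odot>\<^bsub>R\<^esub> r = scalar_hom R a \<otimes>\<^bsub>R\<^esub> r"
    using algebra.smult_assoc2[OF algebra assms(1) R.one_closed assms(2)] assms
    by (simp add: scalar_hom_def)
  then show ?thesis
    using assms by (simp add: R.m_comm)
qed

lemma scalar_hom_ring_hom: "scalar_hom R \<in> ring_hom F R"
proof -
  have mod: "module F R" using algebra by (simp add: algebra_def)
  show ?thesis
  proof (rule ring_hom_memI)
    fix a b assume ab: "a \<in> carrier F" "b \<in> carrier F"
    have "scalar_hom R (a \<otimes>\<^bsub>F\<^esub> b) = a \<odot>\<^bsub>R\<^esub> scalar_hom R b"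
      using module.smult_assoc1[OF mod ab R.one_closed] by (simp add: scalar_hom_def)
    also have "\<dots> = scalar_hom R a \<otimes>\<^bsub>R\<^esub> scalar_hom R b"
      using ab by (simp add: scalar_hom_smult R.m_comm)
    finally show "scalar_hom R (a \<otimes>\<^bsub>F\<^esub> b) = scalar_hom R a \<otimes>\<^bsub>R\<^esub> scalar_hom R b" .
    show "scalar_hom R (a \<oplus>\<^bsub>F\<^esub> b) = scalar_hom R a \<oplus>\<^bsub>R\<^esub> scalar_hom R b"
      using module.smult_l_distr[OF mod ab R.one_closed] by (simp add: scalar_hom_def)
  next
    show "scalar_hom R \<one>\<^bsub>F\<^esub> = \<one>\<^bsub>R\<^esub>"
      using module.smult_one[OF mod R.one_closed] by (simp add: scalar_hom_def)
  qed simp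
qed

end

text \<open>
  The coordinates of \<open>w \<otimes> r\<close>.
\<close>

definition pure :: "('f, 'r) module \<Rightarrow> (nat \<Rightarrow> 'f) \<Rightarrow> 'r \<Rightarrow> nat \<Rightarrow> 'r" where
  "pure R w r = r \<odot>\<^bsub>W2 R\<^esub> W2_map (scalar_hom R) w"

text \<open>
  Additive maps out of the free abelian group are determined by the pure tensors, so the choice is
  unique on the carrier; its existence is the universal property of the free abelian group.
\<close>

definition tensor_coords ::
    "('f, 'm) ring_scheme \<Rightarrow> ('f, 'r) module \<Rightarrow> (nat \<Rightarrow> 'f, 'r) tensor_rep \<Rightarrow> nat \<Rightarrow> 'r" where
  "tensor_coords F R =
     (SOME \<kappa>. \<kappa> \<in> hom (tensor_free (W2 F) R) (add_monoid (W2 R)) \<and>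
        (\<forall>w\<in>carrier (W2 F). \<forall>r\<in>carrier R. \<kappa> (frag_of (w, r)) = pure R w r))"

lemma tensor_free_closed [simp]:
  "0 \<in> carrier (tensor_free M R)"
  "x \<in> carrier (tensor_free M R) \<Longrightarrow> y \<in> carrier (tensor_free M R) \<Longrightarrow> x + y \<in> carrier (tensor_free M R)"
  "x \<in> carrier (tensor_free M R) \<Longrightarrow> y \<in> carrier (tensor_free M R) \<Longrightarrow> x - y \<in> carrier (tensor_free M R)"
  "frag_of (m, r) \<in> carrier (tensor_free M R) \<longleftrightarrow> m \<in> carrier M \<and> r \<in> carrier R"
  using keys_add[of x y] keys_diff[of x y] by (auto simp: tensor_free_def)

lemma tensor_free_induct [consumes 1, case_names zero diff pure]:
  assumes "c \<in> carrier (tensor_free M R)"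
    and "P 0"
    and "\<And>x y. x \<in> carrier (tensor_free M R) \<Longrightarrow> y \<in> carrier (tensor_free M R) \<Longrightarrow> P x \<Longrightarrow> P y \<Longrightarrow> P (x - y)"
    and "\<And>m r. m \<in> carrier M \<Longrightarrow> r \<in> carrier R \<Longrightarrow> P (frag_of (m, r))"
  shows "P c"
proof -
  have "Poly_Mapping.keys c \<subseteq> carrier M \<times> carrier R"
    using assms(1) by (simp add: tensor_free_def)
  then show ?thesis
    by (rule free_Abelian_group_induct) (use assms(2-4) in \<open>auto simp: tensor_free_def\<close>)
qed

context scalar_extension
begin

lemma pure_closed [simp]:
  assumes "w \<in> carrier (W2 F)" "r \<in> carrier R"
  shows "pure R w r \<in> carrier (W2 R)"
  unfolding pure_def using assms by (intro R.W2_smult_closed W2_map_closed[OF scalar_hom_ring_hom])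

lemma tensor_coords_spec:
  "tensor_coords F R \<in> hom (tensor_free (W2 F) R) (add_monoid (W2 R)) \<and>
     (\<forall>w\<in>carrier (W2 F). \<forall>r\<in>carrier R. tensor_coords F R (frag_of (w, r)) = pure R w r)"
proof -
  interpret W: comm_group "add_monoid (W2 R)"
    using R.W2_abelian_group by (rule abelian_group.a_comm_group)
  have "(\<lambda>(w, r). pure R w r) ` (carrier (W2 F) \<times> carrier R) \<subseteq> carrier (add_monoid (W2 R))"
    by auto
  then obtain h where "h \<in> hom (free_Abelian_group (carrier (W2 F) \<times> carrier R)) (add_monoid (W2 R))"
    "\<And>p. p \<in> carrier (W2 F) \<times> carrier R \<Longrightarrow> h (frag_of p) = (\<lambda>(w, r). pure R w r) p"
    by (rule W.free_Abelian_group_universal) blast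
  then have "\<exists>\<kappa>. \<kappa> \<in> hom (tensor_free (W2 F) R) (add_monoid (W2 R)) \<and>
     (\<forall>w\<in>carrier (W2 F). \<forall>r\<in>carrier R. \<kappa> (frag_of (w, r)) = pure R w r)"
    by (intro exI[of _ h]) (auto simp: tensor_free_def)
  then show ?thesis
    unfolding tensor_coords_def by (rule someI_ex)
qed

abbreviation "\<kappa> \<equiv> tensor_coords F R"
abbreviation "T \<equiv> tensor_free (W2 F) R"
abbreviation "N \<equiv> tensor_kernel F (W2 F) R"

lemma coords_frag_of [simp]:
  "w \<in> carrier (W2 F) \<Longrightarrow> r \<in> carrier R \<Longrightarrow> \<kappa> (frag_of (w, r)) = pure R w r"
  using tensor_coords_spec by blast

lemma coords_closed [simp]: "c \<in> carrier T \<Longrightarrow> \<kappa> c \<in> carrier (W2 R)"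
  using tensor_coords_spec hom_in_carrier[of \<kappa> T "add_monoid (W2 R)" c] by simp

lemma coords_add:
  "c \<in> carrier T \<Longrightarrow> d \<in> carrier T \<Longrightarrow> \<kappa> (c + d) = \<kappa> c \<oplus>\<^bsub>W2 R\<^esub> \<kappa> d"
  using tensor_coords_spec hom_mult[of \<kappa> T "add_monoid (W2 R)" c d] by (simp add: tensor_free_def)

lemma group_hom_coords: "group_hom T (add_monoid (W2 R)) \<kappa>"
  using tensor_coords_spec abelian_group.a_group[OF R.W2_abelian_group]
  by (intro group_hom.intro) (simp_all add: group_hom_axioms_def tensor_free_def)

lemma coords_zero: "\<kappa> 0 = \<zero>\<^bsub>W2 R\<^esub>"
  using group_hom.hom_one[OF group_hom_coords] by (simp add: tensor_free_def)

lemma coords_diff: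
  "c \<in> carrier T \<Longrightarrow> d \<in> carrier T \<Longrightarrow> \<kappa> c = \<kappa> (c - d) \<oplus>\<^bsub>W2 R\<^esub> \<kappa> d"
  using coords_add[of "c - d" d] by simp

lemma coords_diff_eq_zero:
  assumes "c \<in> carrier T" "d \<in> carrier T"
  shows "\<kappa> (c - d) = \<zero>\<^bsub>W2 R\<^esub> \<longleftrightarrow> \<kappa> c = \<kappa> d"
proof -
  interpret W: abelian_group "W2 R" by (rule R.W2_abelian_group)
  have "\<kappa> (c - d) = \<zero>\<^bsub>W2 R\<^esub> \<longleftrightarrow> \<kappa> (c - d) \<oplus>\<^bsub>W2 R\<^esub> \<kappa> d = \<zero>\<^bsub>W2 R\<^esub> \<oplus>\<^bsub>W2 R\<^esub> \<kappa> d"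
    using assms by (subst W.add.right_cancel) simp_all
  then show ?thesis
    using assms coords_diff[OF assms] by simp
qed

end

lemma (in cring) W2_smult_add:
  assumes "s \<in> carrier R" "x \<in> carrier (W2 R)" "y \<in> carrier (W2 R)"
  shows "s \<odot>\<^bsub>W2 R\<^esub> (x \<oplus>\<^bsub>W2 R\<^esub> y) = s \<odot>\<^bsub>W2 R\<^esub> x \<oplus>\<^bsub>W2 R\<^esub> s \<odot>\<^bsub>W2 R\<^esub> y"
  using assms(1) W2_coord[OF assms(2)] W2_coord[OF assms(3)]
  by (intro W2_eqI) (simp_all add: r_distr)

definition unit_vec :: "('f, 'm) ring_scheme \<Rightarrow> nat \<Rightarrow> nat \<Rightarrow> 'f" where
  "unit_vec F i = (\<lambda>k\<in>{1..6}. if k = i then \<one>\<^bsub>F\<^esub> else \<zero>\<^bsub>F\<^esub>)"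

text \<open>
  The normal form of a tensor with coordinates \<open>v\<close>.
\<close>

definition std_tensor :: "('f, 'm) ring_scheme \<Rightarrow> (nat \<Rightarrow> 'r) \<Rightarrow> (nat \<Rightarrow> 'f, 'r) tensor_rep" where
  "std_tensor F v = (\<Sum>i\<in>{1..6}. frag_of (unit_vec F i, v i))"

text \<open>
  A tensor is a coset of the group of relations, and these cosets are the fibers of the coordinate map
  (\<open>tensor_class_eq_fiber\<close> below). This makes the fiber map an explicit isomorphism from the coordinate
  algebra to the tensor product.
\<close>

definition tensor_fiber ::
    "('f, 'm) ring_scheme \<Rightarrow> ('f, 'r) module \<Rightarrow> (nat \<Rightarrow> 'r) \<Rightarrow> (nat \<Rightarrow> 'f, 'r) tensor" where
  "tensor_fiber F R v = {c \<in> carrier (tensor_free (W2 F) R). tensor_coords F R c = v}"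

lemma W2_carrierI: "x \<in> extensional {1..6} \<Longrightarrow> (\<And>k. k \<in> {1..6} \<Longrightarrow> x k \<in> carrier R) \<Longrightarrow> x \<in> carrier (W2 R)"
  by (simp add: W2_carrier_iff)

lemma W2_eq_coordsI:
  fixes x y :: "nat \<Rightarrow> 'a"
  assumes "x \<in> extensional {1..6}" "y \<in> extensional {1..6}" "\<And>k. k \<in> {1..6} \<Longrightarrow> x k = y k"
  shows "x = y"
  using assms by (rule extensionalityI)

context scalar_extension
begin

lemma pure_extensional [simp]: "pure R w r \<in> extensional {1..6}"
  by (simp add: pure_def)

lemma pure_coord [simp]: "k \<in> {1..6} \<Longrightarrow> pure R w r k = r \<otimes>\<^bsub>R\<^esub> scalar_hom R (w k)"
  by (simp add: pure_def)

lemma pure_add_left: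
  assumes "w \<in> carrier (W2 F)" "w' \<in> carrier (W2 F)" "r \<in> carrier R"
  shows "pure R (w \<oplus>\<^bsub>W2 F\<^esub> w') r = pure R w r \<oplus>\<^bsub>W2 R\<^esub> pure R w' r"
  by (rule W2_eq_coordsI)
    (use assms W2_coord_closed[OF assms(1)] W2_coord_closed[OF assms(2)] in
      \<open>simp_all add: ring_hom_add[OF scalar_hom_ring_hom] R.r_distr\<close>)

lemma pure_add_right:
  assumes "w \<in> carrier (W2 F)" "r \<in> carrier R" "r' \<in> carrier R"
  shows "pure R w (r \<oplus>\<^bsub>R\<^esub> r') = pure R w r \<oplus>\<^bsub>W2 R\<^esub> pure R w r'"
  by (rule W2_eq_coordsI)
    (use assms W2_coord_closed[OF assms(1)] in \<open>simp_all add: R.l_distr\<close>)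

lemma pure_smult:
  assumes "a \<in> carrier F" "w \<in> carrier (W2 F)" "r \<in> carrier R"
  shows "pure R (a \<odot>\<^bsub>W2 F\<^esub> w) r = pure R w (a \<odot>\<^bsub>R\<^esub> r)"
  by (rule W2_eq_coordsI)
    (use assms W2_coord_closed[OF assms(2)] in
      \<open>simp_all add: ring_hom_mult[OF scalar_hom_ring_hom] scalar_hom_smult R.m_assoc\<close>)

lemma pure_scale:
  assumes "w \<in> carrier (W2 F)" "r \<in> carrier R" "s \<in> carrier R"
  shows "pure R w (s \<otimes>\<^bsub>R\<^esub> r) = s \<odot>\<^bsub>W2 R\<^esub> pure R w r"
  by (rule W2_eq_coordsI)
    (use assms W2_coord_closed[OF assms(1)] in \<open>simp_all add: R.m_assoc\<close>)

lemma pure_mult: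
  assumes "w \<in> carrier (W2 F)" "w' \<in> carrier (W2 F)" "r \<in> carrier R" "r' \<in> carrier R"
  shows "pure R (w \<otimes>\<^bsub>W2 F\<^esub> w') (r \<otimes>\<^bsub>R\<^esub> r') = pure R w r \<otimes>\<^bsub>W2 R\<^esub> pure R w' r'"
  unfolding pure_def
  using assms
  by (simp add: W2_map_mult[OF F.cring_axioms R.cring_axioms scalar_hom_ring_hom]
      R.W2_smult_mult_smult W2_map_closed[OF scalar_hom_ring_hom])

lemma tensor_relations_closed: "tensor_relations F (W2 F) R \<subseteq> carrier T"
  by (auto simp: tensor_relations_def)

lemma subgroup_kernel_N: "subgroup N T"
proof -
  interpret T: group T by (simp add: tensor_free_def)
  show ?thesis
    unfolding tensor_kernel_def by (rule T.generate_is_subgroup[OF tensor_relations_closed])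
qed

lemma N_closed: "c \<in> N \<Longrightarrow> c \<in> carrier T"
  using subgroup.subset[OF subgroup_kernel_N] by blast

lemma N_zero [simp]: "0 \<in> N"
  using subgroup.one_closed[OF subgroup_kernel_N] by (simp add: tensor_free_def)

lemma N_add: "c \<in> N \<Longrightarrow> d \<in> N \<Longrightarrow> c + d \<in> N"
  using subgroup.m_closed[OF subgroup_kernel_N, of c d] by (simp add: tensor_free_def)

lemma N_uminus: "c \<in> N \<Longrightarrow> - c \<in> N"
  using subgroup.m_inv_closed[OF subgroup_kernel_N, of c] N_closed[of c] by (simp add: tensor_free_def)

lemma N_diff: "c \<in> N \<Longrightarrow> d \<in> N \<Longrightarrow> c - d \<in> N"
  using N_add[of c "- d"] N_uminus[of d] by simp

lemma N_sum: "(\<And>i. i \<in> I \<Longrightarrow> f i \<in> N) \<Longrightarrow> (\<Sum>i\<in>I. f i) \<in> N"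
  by (induct I rule: infinite_finite_induct) (simp_all add: N_add)

lemma N_relations:
  shows "\<lbrakk>m \<in> carrier (W2 F); m' \<in> carrier (W2 F); r \<in> carrier R\<rbrakk> \<Longrightarrow>
      frag_of (m \<oplus>\<^bsub>W2 F\<^esub> m', r) - frag_of (m, r) - frag_of (m', r) \<in> N"
    and "\<lbrakk>m \<in> carrier (W2 F); r \<in> carrier R; r' \<in> carrier R\<rbrakk> \<Longrightarrow>
      frag_of (m, r \<oplus>\<^bsub>R\<^esub> r') - frag_of (m, r) - frag_of (m, r') \<in> N"
    and "\<lbrakk>a \<in> carrier F; m \<in> carrier (W2 F); r \<in> carrier R\<rbrakk> \<Longrightarrow>
      frag_of (a \<odot>\<^bsub>W2 F\<^esub> m, r) - frag_of (m, a \<odot>\<^bsub>R\<^esub> r) \<in> N"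
proof -
  have rel: "x \<in> N" if "x \<in> tensor_relations F (W2 F) R" for x
    unfolding tensor_kernel_def using that by (rule generate.incl)
  show "frag_of (m \<oplus>\<^bsub>W2 F\<^esub> m', r) - frag_of (m, r) - frag_of (m', r) \<in> N"
    if "m \<in> carrier (W2 F)" "m' \<in> carrier (W2 F)" "r \<in> carrier R"
    by (rule rel, unfold tensor_relations_def) (use that in blast)
  show "frag_of (m, r \<oplus>\<^bsub>R\<^esub> r') - frag_of (m, r) - frag_of (m, r') \<in> N"
    if "m \<in> carrier (W2 F)" "r \<in> carrier R" "r' \<in> carrier R"
    by (rule rel, unfold tensor_relations_def) (use that in blast)
  show "frag_of (a \<odot>\<^bsub>W2 F\<^esub> m, r) - frag_of (m, a \<odot>\<^bsub>R\<^esub> r) \<in> N"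
    if "a \<in> carrier F" "m \<in> carrier (W2 F)" "r \<in> carrier R"
    by (rule rel, unfold tensor_relations_def) (use that in blast)
qed

lemma N_frag_of_zero:
  assumes "m \<in> carrier (W2 F)" "r \<in> carrier R"
  shows "frag_of (m, \<zero>\<^bsub>R\<^esub>) \<in> N" "frag_of (\<zero>\<^bsub>W2 F\<^esub>, r) \<in> N"
proof -
  interpret W: abelian_group "W2 F" by (rule F.W2_abelian_group)
  have "- frag_of (m, \<zero>\<^bsub>R\<^esub>) \<in> N"
    using N_relations(2)[OF assms(1) R.zero_closed R.zero_closed] by simp
  from N_uminus[OF this] show "frag_of (m, \<zero>\<^bsub>R\<^esub>) \<in> N" by simp
  have "- frag_of (\<zero>\<^bsub>W2 F\<^esub>, r) \<in> N"
    using N_relations(1)[OF W.zero_closed W.zero_closed assms(2)] by simp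
  from N_uminus[OF this] show "frag_of (\<zero>\<^bsub>W2 F\<^esub>, r) \<in> N" by simp
qed

lemma coords_N:
  assumes "c \<in> N"
  shows "\<kappa> c = \<zero>\<^bsub>W2 R\<^esub>"
proof -
  interpret \<kappa>: group_hom T "add_monoid (W2 R)" \<kappa> by (rule group_hom_coords)
  have *: "\<kappa> (x - y - z) = \<zero>\<^bsub>W2 R\<^esub>"
    if "x \<in> carrier T" "y \<in> carrier T" "z \<in> carrier T" "\<kappa> x = \<kappa> y \<oplus>\<^bsub>W2 R\<^esub> \<kappa> z" for x y z
    using that coords_diff_eq_zero[of x "y + z"] by (simp add: diff_diff_eq coords_add)
  have "tensor_relations F (W2 F) R \<subseteq> kernel T (add_monoid (W2 R)) \<kappa>"
  proof
    fix x assume x: "x \<in> tensor_relations F (W2 F) R"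
    then have "\<kappa> x = \<zero>\<^bsub>W2 R\<^esub>"
      unfolding tensor_relations_def
    proof (elim UnE CollectE exE conjE)
      fix m m' r assume "m \<in> carrier (W2 F)" "m' \<in> carrier (W2 F)" "r \<in> carrier R"
        "x = frag_of (m \<oplus>\<^bsub>W2 F\<^esub> m', r) - frag_of (m, r) - frag_of (m', r)"
      then show ?thesis by (auto intro!: * simp: pure_add_left)
    next
      fix m r r' assume "m \<in> carrier (W2 F)" "r \<in> carrier R" "r' \<in> carrier R"
        "x = frag_of (m, r \<oplus>\<^bsub>R\<^esub> r') - frag_of (m, r) - frag_of (m, r')"
      then show ?thesis by (auto intro!: * simp: pure_add_right)
    next
      fix a m r assume "a \<in> carrier F" "m \<in> carrier (W2 F)" "r \<in> carrier R"
        "x = frag_of (a \<odot>\<^bsub>W2 F\<^esub> m, r) - frag_of (m, a \<odot>\<^bsub>R\<^esub> r)"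
      then show ?thesis by (simp add: coords_diff_eq_zero pure_smult)
    qed
    then show "x \<in> kernel T (add_monoid (W2 R)) \<kappa>"
      using x tensor_relations_closed by (auto simp: kernel_def)
  qed
  then have "N \<subseteq> kernel T (add_monoid (W2 R)) \<kappa>"
    unfolding tensor_kernel_def
    by (rule \<kappa>.G.generate_subgroup_incl[OF _ \<kappa>.subgroup_kernel])
  then show ?thesis
    using assms by (auto simp: kernel_def)
qed

lemma unit_vec_closed [simp]: "unit_vec F i \<in> carrier (W2 F)"
  by (rule W2_carrierI) (simp_all add: unit_vec_def)

text \<open>
  Expand \<open>w\<close> in the standard basis, one basis vector at a time, and move the scalars to the other
  factor.
\<close>

lemma frag_of_expand:
  assumes w: "w \<in> carrier (W2 F)" and r: "r \<in> carrier R"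
  shows "frag_of (w, r) - (\<Sum>i\<in>{1..6}. frag_of (unit_vec F i, w i \<odot>\<^bsub>R\<^esub> r)) \<in> N"
proof -
  define part where "part J = (\<lambda>k\<in>{1..6}. if k \<in> J then w k else \<zero>\<^bsub>F\<^esub>)" for J
  have wc: "w k \<in> carrier F" if "k \<in> {1..6}" for k
    by (rule W2_coord_closed[OF w that])
  have part_closed: "part J \<in> carrier (W2 F)" for J
    by (rule W2_carrierI) (simp_all add: part_def wc)
  have "frag_of (part J, r) - (\<Sum>i\<in>J. frag_of (unit_vec F i, w i \<odot>\<^bsub>R\<^esub> r)) \<in> N"
    if "finite J" "J \<subseteq> {1..6}" for J
    using that
  proof (induct J)
    case empty
    have "part {} = \<zero>\<^bsub>W2 F\<^esub>"
      by (rule W2_eq_coordsI) (simp_all add: part_def)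
    then show ?case using N_frag_of_zero(2)[OF w r] by simp
  next
    case (insert j J)
    then have j: "j \<in> {1..6}" by simp
    let ?u = "w j \<odot>\<^bsub>W2 F\<^esub> unit_vec F j"
    have u: "?u \<in> carrier (W2 F)" using wc[OF j] by simp
    have "part (insert j J) = ?u \<oplus>\<^bsub>W2 F\<^esub> part J"
      by (rule W2_eq_coordsI) (use insert wc in \<open>auto simp: part_def unit_vec_def\<close>)
    then have "frag_of (part (insert j J), r) - frag_of (?u, r) - frag_of (part J, r) \<in> N"
      using N_relations(1)[OF u part_closed r] by simp
    moreover have "frag_of (?u, r) - frag_of (unit_vec F j, w j \<odot>\<^bsub>R\<^esub> r) \<in> N"
      using N_relations(3)[OF wc[OF j] unit_vec_closed r] .
    moreover have "frag_of (part J, r) - (\<Sum>i\<in>J. frag_of (unit_vec F i, w i \<odot>\<^bsub>R\<^esub> r)) \<in> N"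
      using insert by simp
    ultimately have "(frag_of (part (insert j J), r) - frag_of (?u, r) - frag_of (part J, r)) +
        (frag_of (?u, r) - frag_of (unit_vec F j, w j \<odot>\<^bsub>R\<^esub> r)) +
        (frag_of (part J, r) - (\<Sum>i\<in>J. frag_of (unit_vec F i, w i \<odot>\<^bsub>R\<^esub> r))) \<in> N"
      by (intro N_add)
    then show ?case
      using insert by (simp add: algebra_simps)
  qed
  from this[of "{1..6}"]
  have "frag_of (part {1..6}, r) - (\<Sum>i\<in>{1..6}. frag_of (unit_vec F i, w i \<odot>\<^bsub>R\<^esub> r)) \<in> N" by simp
  moreover have "part {1..6} = w"
    by (rule W2_eq_coordsI) (use W2_carrier_extensional[OF w] in \<open>simp_all add: part_def\<close>)
  ultimately show ?thesis by simp
qed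

text \<open>
  Modulo the relations every element of the free abelian group is in normal form. Hence an element with
  vanishing coordinates is a relation, and the coordinate map has no larger kernel.
\<close>

lemma std_tensor_coords:
  assumes "c \<in> carrier T"
  shows "c - std_tensor F (\<kappa> c) \<in> N"
  using assms
proof (induct c rule: tensor_free_induct)
  case zero
  have "std_tensor F \<zero>\<^bsub>W2 R\<^esub> \<in> N"
    unfolding std_tensor_def
  proof (rule N_sum)
    fix i :: nat assume "i \<in> {1..6}"
    then show "frag_of (unit_vec F i, \<zero>\<^bsub>W2 R\<^esub> i) \<in> N"
      using N_frag_of_zero(1)[OF unit_vec_closed R.zero_closed] by simp
  qed
  then show ?case using N_uminus by (simp add: coords_zero)
next
  case (diff x y)
  have "(\<Sum>i\<in>{1..6}. frag_of (unit_vec F i, \<kappa> x i) - frag_of (unit_vec F i, \<kappa> (x - y) i)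
      - frag_of (unit_vec F i, \<kappa> y i)) \<in> N"
  proof (rule N_sum)
    fix i :: nat assume i: "i \<in> {1..6}"
    have "\<kappa> x i = \<kappa> (x - y) i \<oplus>\<^bsub>R\<^esub> \<kappa> y i"
      using coords_diff[OF diff(1,2)] i by simp
    then show "frag_of (unit_vec F i, \<kappa> x i) - frag_of (unit_vec F i, \<kappa> (x - y) i)
        - frag_of (unit_vec F i, \<kappa> y i) \<in> N"
      using diff i N_relations(2)[OF unit_vec_closed, of "\<kappa> (x - y) i" "\<kappa> y i"]
        W2_coord_closed[OF coords_closed, of "x - y" i] W2_coord_closed[OF coords_closed, of y i]
      by simp
  qed
  then have "std_tensor F (\<kappa> x) - std_tensor F (\<kappa> (x - y)) - std_tensor F (\<kappa> y) \<in> N"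
    by (simp add: std_tensor_def sum_subtractf)
  from N_add[OF N_diff[OF diff(3,4)] this] have "(x - std_tensor F (\<kappa> x)) - (y - std_tensor F (\<kappa> y)) +
      (std_tensor F (\<kappa> x) - std_tensor F (\<kappa> (x - y)) - std_tensor F (\<kappa> y)) \<in> N"
    .
  then show ?case by (simp add: algebra_simps)
next
  case (pure w r)
  have "pure R w r i = w i \<odot>\<^bsub>R\<^esub> r" if "i \<in> {1..6}" for i
    using that pure W2_coord_closed[OF pure(1) that] by (simp add: scalar_hom_smult)
  then show ?case
    using frag_of_expand[OF pure] pure by (simp add: std_tensor_def)
qed

lemma N_iff: "c \<in> N \<longleftrightarrow> c \<in> carrier T \<and> \<kappa> c = \<zero>\<^bsub>W2 R\<^esub>"
proof
  assume "c \<in> carrier T \<and> \<kappa> c = \<zero>\<^bsub>W2 R\<^esub>"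
  then have "(c - std_tensor F (\<kappa> c)) - (0 - std_tensor F (\<kappa> 0)) \<in> N"
    by (intro N_diff std_tensor_coords) simp_all
  then show "c \<in> N"
    using \<open>c \<in> carrier T \<and> \<kappa> c = \<zero>\<^bsub>W2 R\<^esub>\<close> by (simp add: coords_zero)
qed (simp add: N_closed coords_N)

lemma coords_surj:
  assumes v: "v \<in> carrier (W2 R)"
  shows "std_tensor F v \<in> carrier T \<and> \<kappa> (std_tensor F v) = v"
proof -
  have vc: "v k \<in> carrier R" if "k \<in> {1..6}" for k
    by (rule W2_coord_closed[OF v that])
  have "(\<Sum>i\<in>J. frag_of (unit_vec F i, v i)) \<in> carrier T \<and>
      (\<forall>k\<in>{1..6}. \<kappa> (\<Sum>i\<in>J. frag_of (unit_vec F i, v i)) k = (if k \<in> J then v k else \<zero>\<^bsub>R\<^esub>))"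
    if "finite J" "J \<subseteq> {1..6}" for J
    using that
  proof (induct J)
    case empty
    then show ?case by (simp add: coords_zero)
  next
    case (insert j J)
    then have j: "j \<in> {1..6}" and IH: "(\<Sum>i\<in>J. frag_of (unit_vec F i, v i)) \<in> carrier T"
      "\<And>k. k \<in> {1..6} \<Longrightarrow> \<kappa> (\<Sum>i\<in>J. frag_of (unit_vec F i, v i)) k = (if k \<in> J then v k else \<zero>\<^bsub>R\<^esub>)"
      by auto
    have "v j \<otimes>\<^bsub>R\<^esub> scalar_hom R (unit_vec F j k) = (if k = j then v k else \<zero>\<^bsub>R\<^esub>)" if "k \<in> {1..6}" for k
      using vc[OF j] that ring_hom_one[OF scalar_hom_ring_hom]
        ring_hom_zero[OF scalar_hom_ring_hom F.ring_axioms R.ring_axioms]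
      by (simp add: unit_vec_def)
    then show ?case
      using insert(1,2) IH vc j by (auto simp: coords_add)
  qed
  from this[of "{1..6}"] show ?thesis
    unfolding std_tensor_def[symmetric]
    using W2_carrier_extensional[OF v]
    by (auto intro!: W2_eq_coordsI intro: W2_carrier_extensional[OF coords_closed])
qed

lemma fiber_nonempty: "v \<in> carrier (W2 R) \<Longrightarrow> \<exists>c. c \<in> tensor_fiber F R v"
  using coords_surj[of v] by (auto simp: tensor_fiber_def)

lemma fiber_iff: "c \<in> tensor_fiber F R v \<longleftrightarrow> c \<in> carrier T \<and> \<kappa> c = v"
  by (simp add: tensor_fiber_def)

lemma tensor_class_eq_fiber:
  assumes c: "c \<in> carrier T"
  shows "tensor_class F (W2 F) R c = tensor_fiber F R (\<kappa> c)"
proof -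
  have "tensor_class F (W2 F) R c = (\<lambda>n. n + c) ` N"
    by (auto simp: tensor_class_def r_coset_def tensor_free_def)
  also have "\<dots> = {d \<in> carrier T. d - c \<in> N}"
  proof (intro equalityI subsetI)
    fix d assume "d \<in> {d \<in> carrier T. d - c \<in> N}"
    then show "d \<in> (\<lambda>n. n + c) ` N" by (intro image_eqI[of _ _ "d - c"]) simp_all
  qed (use c N_closed in auto)
  also have "\<dots> = tensor_fiber F R (\<kappa> c)"
    using c by (auto simp: N_iff coords_diff_eq_zero fiber_iff)
  finally show ?thesis .
qed

lemma carrier_base_change: "carrier (base_change F (W2 F) R) = tensor_fiber F R ` carrier (W2 R)"
proof -
  have "carrier (base_change F (W2 F) R) = tensor_class F (W2 F) R ` carrier T"
    by (auto simp: base_change_def FactGroup_def RCOSETS_def tensor_class_def)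
  also have "\<dots> = tensor_fiber F R ` (\<kappa> ` carrier T)"
    by (simp add: image_image tensor_class_eq_fiber)
  also have "\<kappa> ` carrier T = carrier (W2 R)"
    using coords_surj by (force simp: image_iff)
  finally show ?thesis .
qed

lemma fiber_add:
  assumes "v \<in> carrier (W2 R)" "w \<in> carrier (W2 R)"
  shows "tensor_fiber F R v \<oplus>\<^bsub>base_change F (W2 F) R\<^esub> tensor_fiber F R w =
    tensor_fiber F R (v \<oplus>\<^bsub>W2 R\<^esub> w)"
proof -
  interpret W: abelian_group "W2 R" by (rule R.W2_abelian_group)
  obtain a where a: "a \<in> carrier T" "\<kappa> a = v"
    using fiber_nonempty[OF assms(1)] by (auto simp: fiber_iff)
  have "tensor_fiber F R v \<oplus>\<^bsub>base_change F (W2 F) R\<^esub> tensor_fiber F R w =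
      {c + d | c d. c \<in> tensor_fiber F R v \<and> d \<in> tensor_fiber F R w}"
    by (auto simp: base_change_def FactGroup_def set_mult_def tensor_free_def)
  also have "\<dots> = tensor_fiber F R (v \<oplus>\<^bsub>W2 R\<^esub> w)"
  proof (intro equalityI subsetI)
    fix d assume d: "d \<in> tensor_fiber F R (v \<oplus>\<^bsub>W2 R\<^esub> w)"
    then have "\<kappa> (d - a) \<oplus>\<^bsub>W2 R\<^esub> v = w \<oplus>\<^bsub>W2 R\<^esub> v"
      using coords_diff[of d a] a assms by (simp add: fiber_iff W.a_comm)
    then have "\<kappa> (d - a) = w"
      using a d assms by (subst (asm) W.add.right_cancel) (simp_all add: fiber_iff)
    then have "d - a \<in> tensor_fiber F R w" "d = a + (d - a)"
      using a d by (simp_all add: fiber_iff)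
    then show "d \<in> {c + d | c d. c \<in> tensor_fiber F R v \<and> d \<in> tensor_fiber F R w}"
      using a unfolding fiber_iff by blast
  qed (auto simp: fiber_iff coords_add)
  finally show ?thesis .
qed

end

text \<open>
  The operations on the tensor product are defined on representatives by extending a map on pure
  tensors. If on pure tensors such a map is given in coordinates by an additive map \<open>h\<close>, then so is the
  extension; in particular its effect on coordinates does not depend on the representative.
\<close>

lemma coords_frag_extend:
  assumes R: "scalar_extension F R" and S: "scalar_extension F S"
    and g: "\<And>w r. w \<in> carrier (W2 F) \<Longrightarrow> r \<in> carrier R \<Longrightarrow>
      g (w, r) \<in> carrier (tensor_free (W2 F) S) \<and> tensor_coords F S (g (w, r)) = h (pure R w r)"
    and h: "\<And>x. x \<in> carrier (W2 R) \<Longrightarrow> h x \<in> carrier (W2 S)"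
    and h_add: "\<And>x y. x \<in> carrier (W2 R) \<Longrightarrow> y \<in> carrier (W2 R) \<Longrightarrow> h (x \<oplus>\<^bsub>W2 R\<^esub> y) = h x \<oplus>\<^bsub>W2 S\<^esub> h y"
    and c: "c \<in> carrier (tensor_free (W2 F) R)"
  shows "frag_extend g c \<in> carrier (tensor_free (W2 F) S) \<and>
    tensor_coords F S (frag_extend g c) = h (tensor_coords F R c)"
  using c
proof (induct c rule: tensor_free_induct)
  interpret R: scalar_extension F R by (rule R)
  interpret S: scalar_extension F S by (rule S)
  interpret W: abelian_group "W2 S" by (rule S.R.W2_abelian_group)
  interpret V: abelian_group "W2 R" by (rule R.R.W2_abelian_group)
  {
    case zero
    have "h \<zero>\<^bsub>W2 R\<^esub> \<oplus>\<^bsub>W2 S\<^esub> h \<zero>\<^bsub>W2 R\<^esub> = \<zero>\<^bsub>W2 S\<^esub> \<oplus>\<^bsub>W2 S\<^esub> h \<zero>\<^bsub>W2 R\<^esub>"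
      using h_add[OF V.zero_closed V.zero_closed] h[OF V.zero_closed] by simp
    then have "h \<zero>\<^bsub>W2 R\<^esub> = \<zero>\<^bsub>W2 S\<^esub>"
      using h[OF V.zero_closed] by (subst (asm) W.add.right_cancel) simp_all
    then show ?case by (simp add: R.coords_zero S.coords_zero)
  next
    case (diff x y)
    let ?x = "frag_extend g x" and ?y = "frag_extend g y"
    have "tensor_coords F S (?x - ?y) \<oplus>\<^bsub>W2 S\<^esub> tensor_coords F S ?y =
        h (tensor_coords F R (x - y)) \<oplus>\<^bsub>W2 S\<^esub> tensor_coords F S ?y"
      using diff S.coords_diff[of ?x ?y] R.coords_diff[of x y] h_add[of "tensor_coords F R (x - y)" "tensor_coords F R y"]
      by simp
    then have "tensor_coords F S (?x - ?y) = h (tensor_coords F R (x - y))"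
      using diff h by (subst (asm) W.add.right_cancel) simp_all
    then show ?case using diff by (simp add: frag_extend_diff)
  next
    case (pure w r)
    then show ?case using g by (simp add: R.coords_frag_of)
  }
qed

context scalar_extension
begin

lemma scalar_extension: "scalar_extension F R"
  by unfold_locales

lemma fiber_smult:
  assumes s: "s \<in> carrier R" and v: "v \<in> carrier (W2 R)"
  shows "s \<odot>\<^bsub>base_change F (W2 F) R\<^esub> tensor_fiber F R v = tensor_fiber F R (s \<odot>\<^bsub>W2 R\<^esub> v)"
proof -
  let ?g = "\<lambda>(w, r). frag_of (w, s \<otimes>\<^bsub>R\<^esub> r)"
  have "frag_extend ?g c \<in> carrier T \<and> \<kappa> (frag_extend ?g c) = s \<odot>\<^bsub>W2 R\<^esub> \<kappa> c" if "c \<in> carrier T" for c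
    using s by (intro coords_frag_extend[OF scalar_extension scalar_extension _ _ _ that])
      (simp_all add: pure_scale R.W2_smult_add)
  then have "tensor_class F (W2 F) R (frag_extend ?g c) = tensor_fiber F R (s \<odot>\<^bsub>W2 R\<^esub> v)"
    if "c \<in> tensor_fiber F R v" for c
    using that by (simp add: tensor_class_eq_fiber fiber_iff)
  then show ?thesis
    using fiber_nonempty[OF v] by (auto simp: base_change_def)
qed

lemma fiber_mult:
  assumes v: "v \<in> carrier (W2 R)" and w: "w \<in> carrier (W2 R)"
  shows "tensor_fiber F R v \<otimes>\<^bsub>base_change F (W2 F) R\<^esub> tensor_fiber F R w =
    tensor_fiber F R (v \<otimes>\<^bsub>W2 R\<^esub> w)"
proof -
  let ?g = "\<lambda>u r (w', r'). frag_of (u \<otimes>\<^bsub>W2 F\<^esub> w', r \<otimes>\<^bsub>R\<^esub> r')"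
  let ?h = "\<lambda>d (u, r). frag_extend (?g u r) d"
  have inner: "frag_extend (?g u r) d \<in> carrier T \<and> \<kappa> (frag_extend (?g u r) d) = pure R u r \<otimes>\<^bsub>W2 R\<^esub> \<kappa> d"
    if "d \<in> carrier T" "u \<in> carrier (W2 F)" "r \<in> carrier R" for u r d
    using that(2,3)
    by (intro coords_frag_extend[OF scalar_extension scalar_extension _ _ _ that(1)])
      (simp_all add: pure_mult R.W2_mult_add_right)
  have "frag_extend (?h d) c \<in> carrier T \<and> \<kappa> (frag_extend (?h d) c) = \<kappa> c \<otimes>\<^bsub>W2 R\<^esub> \<kappa> d"
    if "c \<in> carrier T" "d \<in> carrier T" for c d
    by (intro coords_frag_extend[OF scalar_extension scalar_extension _ _ _ that(1)])
      (use that inner[OF that(2)] in \<open>simp_all add: R.W2_mult_add_left\<close>)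
  then have "tensor_class F (W2 F) R (frag_extend (?h d) c) = tensor_fiber F R (v \<otimes>\<^bsub>W2 R\<^esub> w)"
    if "c \<in> tensor_fiber F R v" "d \<in> tensor_fiber F R w" for c d
    using that by (simp add: tensor_class_eq_fiber fiber_iff)
  then show ?thesis
    using fiber_nonempty[OF v] fiber_nonempty[OF w] by (auto simp: base_change_def)
qed

lemma fiber_alg_iso: "tensor_fiber F R \<in> alg_iso R (W2 R) (base_change F (W2 F) R)"
proof -
  have "inj_on (tensor_fiber F R) (carrier (W2 R))"
  proof (rule inj_onI)
    fix v w assume "v \<in> carrier (W2 R)" "w \<in> carrier (W2 R)" "tensor_fiber F R v = tensor_fiber F R w"
    then show "v = w" using fiber_nonempty[of v] by (auto simp: fiber_iff)
  qed
  then have "bij_betw (tensor_fiber F R) (carrier (W2 R)) (carrier (base_change F (W2 F) R))"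
    by (simp add: bij_betw_def carrier_base_change)
  then show ?thesis
    by (simp add: alg_iso_def fiber_add fiber_mult fiber_smult)
qed

end

text \<open>
  A homomorphism of \<open>F\<close>-algebras commutes with the structure maps from \<open>F\<close>, through which the
  coordinates of \<open>w \<otimes> r\<close> are formed.
\<close>

lemma base_change_map_fiber:
  assumes R: "scalar_extension F R" and S: "scalar_extension F S"
    and f: "f \<in> alg_hom F R S" and v: "v \<in> carrier (W2 R)"
  shows "base_change_map F (W2 F) S f (tensor_fiber F R v) = tensor_fiber F S (W2_map f v)"
proof -
  interpret R: scalar_extension F R by (rule R)
  interpret S: scalar_extension F S by (rule S)
  have hom: "f \<in> ring_hom R S" using f by (simp add: alg_hom_def)
  have fs: "f (scalar_hom R a) = scalar_hom S a" if "a \<in> carrier F" for a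
    using f that ring_hom_one[OF hom] by (simp add: alg_hom_def scalar_hom_def)
  let ?g = "\<lambda>(w, r). frag_of (w, f r)"
  have pure: "pure S w (f r) = W2_map f (pure R w r)" if "w \<in> carrier (W2 F)" "r \<in> carrier R" for w r
    by (rule W2_eq_coordsI)
      (use that W2_coord_closed[OF that(1)] in \<open>simp_all add: ring_hom_mult[OF hom] fs\<close>)
  have "frag_extend ?g c \<in> carrier (tensor_free (W2 F) S) \<and>
      tensor_coords F S (frag_extend ?g c) = W2_map f (tensor_coords F R c)"
    if "c \<in> carrier (tensor_free (W2 F) R)" for c
    by (intro coords_frag_extend[OF R S _ _ _ that])
      (simp_all add: pure ring_hom_closed[OF hom] W2_map_closed[OF hom] W2_map_add[OF hom])
  then have "tensor_class F (W2 F) S (frag_extend ?g c) = tensor_fiber F S (W2_map f v)"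
    if "c \<in> tensor_fiber F R v" for c
    using that by (simp add: S.tensor_class_eq_fiber R.fiber_iff)
  then show ?thesis
    using R.fiber_nonempty[OF v] by (auto simp: base_change_map_def)
qed

section \<open>The affine group functor and the isomorphism\<close>

lemma algebra_imp_scalar_extension: "algebra F R \<Longrightarrow> scalar_extension F R"
  by (simp add: scalar_extension_def scalar_extension_axioms_def algebra_def module_def)

lemma ring_hom_Units:
  assumes R: "cring R" and S: "cring S" and h: "h \<in> ring_hom R S" and u: "u \<in> Units R"
  shows "h u \<in> Units S" "h (inv\<^bsub>R\<^esub> u) = inv\<^bsub>S\<^esub> (h u)"
proof -
  interpret R: cring R by (rule R)
  interpret S: cring S by (rule S)
  have c: "h u \<in> carrier S" "h (inv\<^bsub>R\<^esub> u) \<in> carrier S"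
    using u by (simp_all add: ring_hom_closed[OF h] R.Units_closed)
  have "h u \<otimes>\<^bsub>S\<^esub> h (inv\<^bsub>R\<^esub> u) = \<one>\<^bsub>S\<^esub>"
    using u ring_hom_mult[OF h, of u "inv\<^bsub>R\<^esub> u"] ring_hom_one[OF h] by (simp add: R.Units_closed)
  moreover from this have "h (inv\<^bsub>R\<^esub> u) \<otimes>\<^bsub>S\<^esub> h u = \<one>\<^bsub>S\<^esub>"
    using c by (simp add: S.m_comm)
  ultimately show "h u \<in> Units S" "h (inv\<^bsub>R\<^esub> u) = inv\<^bsub>S\<^esub> (h u)"
    using c S.inv_unique'[of "h u" "h (inv\<^bsub>R\<^esub> u)"] by (auto simp: Units_def)
qed

text \<open>
  If \<open>3 = 0\<close> in \<open>F\<close>, then \<open>3\<close> is the least positive multiple of \<open>1\<close> that vanishes, since \<open>1 = 0\<close> is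
  impossible and \<open>2 = 0\<close> would imply it.
\<close>

lemma three_in_Units:
  assumes F: "field F" and char: "characteristic F \<noteq> 3"
  shows "\<guillemotleft>3\<guillemotright>\<^bsub>F\<^esub> \<in> Units F"
proof -
  interpret field F by (rule F)
  have pow: "[n] \<cdot>\<^bsub>F\<^esub> \<one>\<^bsub>F\<^esub> = \<guillemotleft>int n\<guillemotright>\<^bsub>F\<^esub>" for n :: nat
    using add_pow_eq_of_integer[OF one_closed, of "int n"] by (simp add: add_pow_int_ge)
  define P where "P n \<longleftrightarrow> 0 < n \<and> [n] \<cdot>\<^bsub>F\<^esub> \<one>\<^bsub>F\<^esub> = \<zero>\<^bsub>F\<^esub>" for n :: nat
  have "\<guillemotleft>3\<guillemotright>\<^bsub>F\<^esub> \<noteq> \<zero>\<^bsub>F\<^esub>"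
  proof
    assume three: "\<guillemotleft>3\<guillemotright>\<^bsub>F\<^esub> = \<zero>\<^bsub>F\<^esub>"
    have sum3: "\<one>\<^bsub>F\<^esub> \<oplus>\<^bsub>F\<^esub> \<guillemotleft>2\<guillemotright>\<^bsub>F\<^esub> = \<guillemotleft>3\<guillemotright>\<^bsub>F\<^esub>"
      using of_int_add[of 1 2] by simp
    have P3: "P 3" using three pow[of 3] by (simp add: P_def)
    have "(LEAST n. P n) = 3"
    proof (rule Least_equality)
      show "P 3" by (rule P3)
      fix n assume n: "P n"
      have "n \<noteq> 1" using n pow[of 1] one_not_zero by (auto simp: P_def)
      moreover have "n \<noteq> 2"
      proof
        assume "n = 2"
        then have "\<guillemotleft>2\<guillemotright>\<^bsub>F\<^esub> = \<zero>\<^bsub>F\<^esub>" using n pow[of 2] by (simp add: P_def)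
        then show False using sum3 three one_not_zero by simp
      qed
      moreover have "0 < n" using n by (simp add: P_def)
      ultimately show "3 \<le> n" by linarith
    qed
    moreover have "characteristic F = (LEAST n. P n)"
      using P3 unfolding characteristic_def P_def by (simp only: if_P exI)
    ultimately show False
      using char by simp
  qed
  then show ?thesis by (simp add: field_Units)
qed

lemma three_in_Units_algebra:
  fixes F :: "('f, 'm) ring_scheme" and R :: "('f, 'r) module"
  assumes "field F" "characteristic F \<noteq> 3" "algebra F R"
  shows "\<guillemotleft>3\<guillemotright>\<^bsub>R\<^esub> \<in> Units R"
proof -
  interpret scalar_extension F R by (rule algebra_imp_scalar_extension[OF assms(3)])
  have "scalar_hom R \<guillemotleft>3\<guillemotright>\<^bsub>F\<^esub> = \<guillemotleft>3\<guillemotright>\<^bsub>R\<^esub>"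
    using scalar_hom_ring_hom
    by (intro ring_hom_of_integer) (simp add: ring_hom_cring_def ring_hom_cring_axioms_def F.cring_axioms R.cring_axioms)
  then show ?thesis
    using ring_hom_Units(1)[OF F.cring_axioms R.cring_axioms scalar_hom_ring_hom three_in_Units[OF assms(1,2)]]
    by simp
qed

lemma (in cring) Aff2_cases:
  assumes "m \<in> carrier (Aff2_group R)"
  obtains y t where "m = Mat2 \<one> y \<zero> t" "y \<in> carrier R" "t \<in> Units R"
  using assms by (auto simp: Aff2_group_def)

lemma (in cring) aff_auto_of_closed:
  assumes "m \<in> carrier (Aff2_group R)" "x \<in> carrier (W2 R)"
  shows "aff_auto_of R m x \<in> carrier (W2 R)"
  using assms(1)
  by (rule Aff2_cases) (simp add: assms(2) alg_isoD(2)[OF aff_auto_alg_iso])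

lemma (in cring) Aff2_mem [simp]:
  "Mat2 \<one> y \<zero> t \<in> carrier (Aff2_group R) \<longleftrightarrow> y \<in> carrier R \<and> t \<in> Units R"
  by (simp add: Aff2_group_def)

lemma (in cring) Aff2_mult:
  assumes "y \<in> carrier R" "t \<in> Units R" "y' \<in> carrier R" "t' \<in> Units R"
  shows "Mat2 \<one> y \<zero> t \<otimes>\<^bsub>Aff2_group R\<^esub> Mat2 \<one> y' \<zero> t' = Mat2 \<one> (y' \<oplus> y \<otimes> t') \<zero> (t \<otimes> t')"
  using assms by (simp add: Aff2_group_def Units_closed)

lemma (in cring) group_Aff2: "group (Aff2_group R)"
proof (rule groupI)
  show "\<one>\<^bsub>Aff2_group R\<^esub> \<in> carrier (Aff2_group R)"
    by (simp add: Aff2_group_def)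
next
  fix m n assume "m \<in> carrier (Aff2_group R)" "n \<in> carrier (Aff2_group R)"
  then show "m \<otimes>\<^bsub>Aff2_group R\<^esub> n \<in> carrier (Aff2_group R)"
    by (elim Aff2_cases) (simp add: Aff2_mult Units_closed)
next
  fix m n k assume "m \<in> carrier (Aff2_group R)" "n \<in> carrier (Aff2_group R)" "k \<in> carrier (Aff2_group R)"
  then show "m \<otimes>\<^bsub>Aff2_group R\<^esub> n \<otimes>\<^bsub>Aff2_group R\<^esub> k = m \<otimes>\<^bsub>Aff2_group R\<^esub> (n \<otimes>\<^bsub>Aff2_group R\<^esub> k)"
    by (elim Aff2_cases) (simp add: Aff2_mult Units_closed l_distr a_assoc m_assoc)
next
  fix m assume "m \<in> carrier (Aff2_group R)"
  then obtain y t where m: "m = Mat2 \<one> y \<zero> t" and y [simp]: "y \<in> carrier R" and t [simp]: "t \<in> Units R"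
    by (rule Aff2_cases)
  have one: "\<one>\<^bsub>Aff2_group R\<^esub> = Mat2 \<one> \<zero> \<zero> \<one>" by (simp add: Aff2_group_def)
  show "\<one>\<^bsub>Aff2_group R\<^esub> \<otimes>\<^bsub>Aff2_group R\<^esub> m = m"
    by (simp add: m one Aff2_mult Units_closed)
  show "\<exists>n\<in>carrier (Aff2_group R). n \<otimes>\<^bsub>Aff2_group R\<^esub> m = \<one>\<^bsub>Aff2_group R\<^esub>"
  proof (rule bexI)
    show "Mat2 \<one> (\<ominus> (y \<otimes> inv t)) \<zero> (inv t) \<otimes>\<^bsub>Aff2_group R\<^esub> m = \<one>\<^bsub>Aff2_group R\<^esub>"
      by (simp add: m one Aff2_mult Units_closed l_minus m_assoc r_neg)
  qed (simp add: Units_closed)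
qed

lemma group_functor_Aff2: "group_functor F (Aff2_functor :: ('f, 'r, 'r mat2) gfunctor)"
proof -
  have cring: "cring R" if "algebra F R" for R :: "('f, 'r) module"
    using that by (simp add: algebra_def)
  have hom: "f \<in> ring_hom R S" if "f \<in> alg_hom F R S" for R S :: "('f, 'r) module" and f
    using that by (simp add: alg_hom_def)
  have map: "map_mat2 f (Mat2 \<one>\<^bsub>R\<^esub> y \<zero>\<^bsub>R\<^esub> t) = Mat2 \<one>\<^bsub>S\<^esub> (f y) \<zero>\<^bsub>S\<^esub> (f t)"
    if "algebra F R" "algebra F S" "f \<in> alg_hom F R S" for R S :: "('f, 'r) module" and f y t
    using ring_hom_one[OF hom[OF that(3)]]
      ring_hom_zero[OF hom[OF that(3)] cring.axioms(1)[OF cring[OF that(1)]] cring.axioms(1)[OF cring[OF that(2)]]]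
    by simp
  show ?thesis
    unfolding group_functor_def
  proof (intro conjI allI impI ballI)
    fix R :: "('f, 'r) module" assume R: "algebra F R"
    interpret R: cring R by (rule cring[OF R])
    show "group (gobj Aff2_functor R)"
      by (simp add: Aff2_functor_def R.group_Aff2)
    fix m assume "m \<in> carrier (gobj Aff2_functor R)"
    then have "m \<in> carrier (Aff2_group R)" by (simp add: Aff2_functor_def)
    then show "gmap Aff2_functor R R (\<lambda>x\<in>carrier R. x) m = m"
      by (elim R.Aff2_cases) (simp add: Aff2_functor_def R.Units_closed)
  next
    fix R S :: "('f, 'r) module" and f
    assume RS: "algebra F R" "algebra F S" "f \<in> alg_hom F R S"
    interpret R: cring R by (rule cring[OF RS(1)])
    interpret S: cring S by (rule cring[OF RS(2)])
    note f = hom[OF RS(3)]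
    note simps = map[OF RS] ring_hom_Units(1)[OF R.cring_axioms S.cring_axioms f] ring_hom_closed[OF f]
    have "map_mat2 f \<in> hom (Aff2_group R) (Aff2_group S)"
    proof (rule homI)
      fix m assume "m \<in> carrier (Aff2_group R)"
      then show "map_mat2 f m \<in> carrier (Aff2_group S)"
        by (elim R.Aff2_cases) (simp add: simps del: mat2.map)
    next
      fix m n assume "m \<in> carrier (Aff2_group R)" "n \<in> carrier (Aff2_group R)"
      then show "map_mat2 f (m \<otimes>\<^bsub>Aff2_group R\<^esub> n) = map_mat2 f m \<otimes>\<^bsub>Aff2_group S\<^esub> map_mat2 f n"
        by (elim R.Aff2_cases) (simp add: simps R.Aff2_mult S.Aff2_mult R.Units_closed
            ring_hom_add[OF f] ring_hom_mult[OF f] del: mat2.map)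
    qed
    then show "gmap Aff2_functor R S f \<in> hom (gobj Aff2_functor R) (gobj Aff2_functor S)"
      by (simp add: Aff2_functor_def)
  next
    fix R S T :: "('f, 'r) module" and f h m
    assume R: "algebra F R" and m: "m \<in> carrier (gobj Aff2_functor R)"
    interpret R: cring R by (rule cring[OF R])
    have "m \<in> carrier (Aff2_group R)" using m by (simp add: Aff2_functor_def)
    then show "gmap Aff2_functor R T (compose (carrier R) h f) m = gmap Aff2_functor S T h (gmap Aff2_functor R S f m)"
      by (elim R.Aff2_cases) (simp add: Aff2_functor_def compose_def R.Units_closed)
  qed
qed

text \<open>
  The formulas for the action are polynomial in \<open>y\<close>, \<open>t\<close> and the inverse of \<open>t\<close>, with integer
  coefficients, and so commute with ring homomorphisms.
\<close>

lemma W2_map_aff_auto_of: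
  assumes R: "cring R" and S: "cring S" and f: "f \<in> ring_hom R S"
    and m: "m \<in> carrier (Aff2_group R)" and v: "v \<in> carrier (W2 R)"
  shows "W2_map f (aff_auto_of R m v) = aff_auto_of S (map_mat2 f m) (W2_map f v)"
proof -
  interpret ring_hom_cring R S f
    using R S f by (simp add: ring_hom_cring_def ring_hom_cring_axioms_def)
  obtain y t where m: "m = Mat2 \<one>\<^bsub>R\<^esub> y \<zero>\<^bsub>R\<^esub> t" and [simp]: "y \<in> carrier R" "t \<in> Units R"
    using m by (rule R.Aff2_cases)
  note [simp] = v W2_coord[OF v] W2_map_closed[OF f v]
  show ?thesis
    unfolding m
    by (rule W2_eqI)
      (simp_all add: R.aff_auto_def S.aff_auto_def R.unip_def S.unip_def R.torus_def S.torus_def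
        ring_hom_of_integer[OF ring_hom_cring_axioms] ring_hom_Units[OF R S f] R.Units_closed
        R.minus_eq S.minus_eq)
qed

definition Aff2_to_aut ::
    "('f, 'm) ring_scheme \<Rightarrow> ('f, 'r) module \<Rightarrow> 'r mat2 \<Rightarrow> (nat \<Rightarrow> 'f, 'r) tensor \<Rightarrow> (nat \<Rightarrow> 'f, 'r) tensor" where
  "Aff2_to_aut F R = alg_conj (W2 R) (base_change F (W2 F) R) (tensor_fiber F R) \<circ> aff_auto_of R"

lemma Aff2_to_aut_iso:
  assumes "field F" "characteristic F \<noteq> 3" "algebra F R"
  shows "Aff2_to_aut F R \<in> iso (Aff2_group R) (AlgAutoGroup R (base_change F (W2 F) R))"
proof -
  interpret scalar_extension F R by (rule algebra_imp_scalar_extension[OF assms(3)])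
  show ?thesis
    unfolding Aff2_to_aut_def
    using R.aff_auto_of_iso[OF three_in_Units_algebra[OF assms]] alg_conj_iso[OF fiber_alg_iso R.ops_closed_W2]
    by (rule iso_set_trans)
qed

lemma Aff2_to_aut_fiber:
  assumes "algebra F R" "v \<in> carrier (W2 R)"
  shows "Aff2_to_aut F R m (tensor_fiber F R v) = tensor_fiber F R (aff_auto_of R m v)"
proof -
  interpret scalar_extension F R by (rule algebra_imp_scalar_extension[OF assms(1)])
  show ?thesis
    using alg_conj_apply[OF fiber_alg_iso assms(2)] by (simp add: Aff2_to_aut_def)
qed

text \<open>
  The transition map of the automorphism functor is the unique automorphism compatible with
  \<open>id \<otimes> f\<close>. Compatibility of the one attached to the image matrix is the naturality of the formulas.
  For uniqueness, every candidate comes from some matrix, and its value on \<open>e\<^sub>2\<close>, which is the image of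
  \<open>e\<^sub>2\<close> under \<open>id \<otimes> f\<close>, determines that matrix.
\<close>

lemma Aff2_to_aut_natural:
  assumes F: "field F" "characteristic F \<noteq> 3" and R: "algebra F R" and S: "algebra F S"
    and f: "f \<in> alg_hom F R S" and m: "m \<in> carrier (Aff2_group R)"
  shows "gmap (aut_functor F (W2 F)) R S f (Aff2_to_aut F R m) = Aff2_to_aut F S (map_mat2 f m)"
proof -
  note R' = algebra_imp_scalar_extension[OF R] and S' = algebra_imp_scalar_extension[OF S]
  interpret R: scalar_extension F R by (rule R')
  interpret S: scalar_extension F S by (rule S')
  have hom: "f \<in> ring_hom R S" using f by (simp add: alg_hom_def)
  let ?A = "base_change F (W2 F) R" and ?B = "base_change F (W2 F) S"
  let ?f = "base_change_map F (W2 F) S f"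
  have fm: "map_mat2 f m \<in> carrier (Aff2_group S)"
  proof -
    have "gmap Aff2_functor R S f \<in> hom (gobj Aff2_functor R) (gobj Aff2_functor S)"
      using group_functor_Aff2[of F] R S f unfolding group_functor_def by blast
    then show ?thesis
      using m by (simp add: Aff2_functor_def hom_in_carrier[of _ "Aff2_group R"])
  qed
  have fiber: "?f (tensor_fiber F R v) = tensor_fiber F S (W2_map f v)" if "v \<in> carrier (W2 R)" for v
    by (rule base_change_map_fiber[OF R' S' f that])
  have nat: "Aff2_to_aut F S (map_mat2 f m) (?f (tensor_fiber F R v)) = ?f (Aff2_to_aut F R m (tensor_fiber F R v))"
    if v: "v \<in> carrier (W2 R)" for v
    using R.R.aff_auto_of_closed[OF m v] v
    by (simp add: fiber Aff2_to_aut_fiber[OF R] Aff2_to_aut_fiber[OF S] W2_map_closed[OF hom]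
        W2_map_aff_auto_of[OF R.R.cring_axioms S.R.cring_axioms hom m])
  have "(THE \<psi>. \<psi> \<in> alg_auto S ?B \<and> (\<forall>x\<in>carrier ?A. \<psi> (?f x) = ?f (Aff2_to_aut F R m x))) =
      Aff2_to_aut F S (map_mat2 f m)"
  proof (rule the_equality)
    show "Aff2_to_aut F S (map_mat2 f m) \<in> alg_auto S ?B \<and>
        (\<forall>x\<in>carrier ?A. Aff2_to_aut F S (map_mat2 f m) (?f x) = ?f (Aff2_to_aut F R m x))"
      using Aff2_to_aut_iso[OF F S] fm nat
      by (auto simp: iso_def R.carrier_base_change dest: hom_in_carrier)
  next
    fix \<psi> assume \<psi>: "\<psi> \<in> alg_auto S ?B \<and> (\<forall>x\<in>carrier ?A. \<psi> (?f x) = ?f (Aff2_to_aut F R m x))"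
    then have "\<psi> \<in> Aff2_to_aut F S ` carrier (Aff2_group S)"
      using Aff2_to_aut_iso[OF F S] by (simp add: iso_def bij_betw_def)
    then obtain n where n: "n \<in> carrier (Aff2_group S)" "\<psi> = Aff2_to_aut F S n"
      by auto
    have w2: "W2_map f R.R.w2 = S.R.w2"
      using ring_hom_one[OF hom] ring_hom_zero[OF hom R.R.ring_axioms S.R.ring_axioms]
      by (intro W2_eqI) simp_all
    have "\<psi> (?f (tensor_fiber F R R.R.w2)) = Aff2_to_aut F S (map_mat2 f m) (?f (tensor_fiber F R R.R.w2))"
      using \<psi> nat[of R.R.w2] by (simp add: R.carrier_base_change)
    then have "tensor_fiber F S (aff_auto_of S n S.R.w2) = tensor_fiber F S (aff_auto_of S (map_mat2 f m) S.R.w2)"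
      by (simp add: fiber w2 n Aff2_to_aut_fiber[OF S])
    then have eq: "aff_auto_of S n S.R.w2 = aff_auto_of S (map_mat2 f m) S.R.w2"
      using bij_betw_imp_inj_on[OF alg_isoD(1)[OF S.fiber_alg_iso]] n(1) fm
      by (simp add: inj_on_eq_iff S.R.aff_auto_of_closed)
    have "n = map_mat2 f m"
      using n(1) fm
    proof (elim S.R.Aff2_cases)
      fix y t y' t' assume *: "n = Mat2 \<one>\<^bsub>S\<^esub> y \<zero>\<^bsub>S\<^esub> t" "map_mat2 f m = Mat2 \<one>\<^bsub>S\<^esub> y' \<zero>\<^bsub>S\<^esub> t'"
        and [simp]: "y \<in> carrier S" "t \<in> Units S" "y' \<in> carrier S" "t' \<in> Units S"
      show ?thesis
        using arg_cong[OF eq, of "\<lambda>x. x 1"] arg_cong[OF eq, of "\<lambda>x. x 2"]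
        by (simp add: * S.R.aff_auto_coords S.R.Units_closed)
    qed
    then show "\<psi> = Aff2_to_aut F S (map_mat2 f m)" by (simp add: n)
  qed
  then show ?thesis by (simp add: aut_functor_def)
qed

theorem theorem21:
  fixes F :: "('f, 'm) ring_scheme"
  assumes "field F" and "characteristic F \<noteq> 3"
  shows "group_functor_isomorphic F
           (aut_functor F (W2 F) ::
              ('f, 'r, (nat \<Rightarrow> 'f, 'r) tensor \<Rightarrow> (nat \<Rightarrow> 'f, 'r) tensor) gfunctor)
           Aff2_functor"
proof (rule group_functor_isomorphic_transport[where \<Lambda> = "Aff2_to_aut F"])
  show "group_functor F Aff2_functor" by (rule group_functor_Aff2)
next
  fix R :: "('f, 'r) module" assume R: "algebra F R"
  interpret scalar_extension F R by (rule algebra_imp_scalar_extension[OF R])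
  show "group (gobj (aut_functor F (W2 F)) R)"
    using group_AlgAutoGroup[OF ops_closed_alg_iso[OF fiber_alg_iso R.ops_closed_W2]]
    by (simp add: aut_functor_def)
  show "Aff2_to_aut F R \<in> iso (gobj Aff2_functor R) (gobj (aut_functor F (W2 F)) R)"
    using Aff2_to_aut_iso[OF assms R] by (simp add: aut_functor_def Aff2_functor_def)
next
  fix R S :: "('f, 'r) module" and f m
  assume "algebra F R" "algebra F S" "f \<in> alg_hom F R S" "m \<in> carrier (gobj Aff2_functor R)"
  then show "gmap (aut_functor F (W2 F)) R S f (Aff2_to_aut F R m) =
      Aff2_to_aut F S (gmap Aff2_functor R S f m)"
    using Aff2_to_aut_natural[OF assms] by (simp add: Aff2_functor_def)
qed

end
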